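(* Let $G$ and $H$ be graphs with $a(G)<a(H)$. Then for all integers $q\geq 2$, $G$ and $H$ are not $q$-Ramsey equivalent.
   Context: Graphs are finite and simple, with at least one vertex. $\chi(G)$ denotes the chromatic number of $G$. A proper vertex colouring is one in which no two adjacent vertices receive the same colour. For a graph $G$, $a(G)$ is the minimum number of vertices which can be given colour $1$ in a proper vertex colouring of $G$ in colours $1,\ldots,\chi(G)$. For an integer $q\geq 2$ and graphs $F$ and $G$, $F\rightarrow (G)_q$ ("$F$ is $q$-Ramsey for $G$") means that every colouring of the edges of $F$ in $q$ colours contains a monochromatic copy of $G$, that is, a (not necessarily induced) subgraph of $F$ isomorphic to $G$ all of whose edges have the same colour. Two graphs $H_1$ and $H_2$ are $q$-Ramsey equivalent if for all graphs $F$, $F\rightarrow (H_1)_q$ if and only if $F\rightarrow (H_2)_q$. *)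

theory Defs
  imports Main "HOL-Library.Ramsey"
begin

type_synonym 'v graph = "'v set \<times> 'v set set"

abbreviation verts :: "'v graph \<Rightarrow> 'v set" where
  "verts \<equiv> fst"

abbreviation edges :: "'v graph \<Rightarrow> 'v set set" where
  "edges \<equiv> snd"

definition is_graph :: "'v graph \<Rightarrow> bool" where
  "is_graph G \<longleftrightarrow> finite (verts G) \<and> verts G \<noteq> {} \<and> edges G \<subseteq> [verts G]\<^bsup>2\<^esup>"

definition subgraph :: "'v graph \<Rightarrow> 'v graph \<Rightarrow> bool" where
  "subgraph K F \<longleftrightarrow> is_graph K \<and> verts K \<subseteq> verts F \<and> edges K \<subseteq> edges F"

definition isomorphic :: "'v graph \<Rightarrow> 'w graph \<Rightarrow> bool" where
  "isomorphic G K \<longleftrightarrow>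
     (\<exists>f. bij_betw f (verts G) (verts K) \<and>
          (\<forall>u\<in>verts G. \<forall>v\<in>verts G. {u, v} \<in> edges G \<longleftrightarrow> {f u, f v} \<in> edges K))"

definition proper_colouring :: "'v graph \<Rightarrow> nat \<Rightarrow> ('v \<Rightarrow> nat) \<Rightarrow> bool" where
  "proper_colouring G k f \<longleftrightarrow>
     f ` verts G \<subseteq> {1..k} \<and>
     (\<forall>u\<in>verts G. \<forall>v\<in>verts G. {u, v} \<in> edges G \<longrightarrow> f u \<noteq> f v)"

definition chromatic_number :: "'v graph \<Rightarrow> nat" where
  "chromatic_number G = (LEAST k. \<exists>f. proper_colouring G k f)"

definition min_colour_class :: "'v graph \<Rightarrow> nat" where
  "min_colour_class G =
     (LEAST n. \<exists>f. proper_colouring G (chromatic_number G) f \<and>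
                  n = card {v \<in> verts G. f v = 1})"

definition q_ramsey :: "'w graph \<Rightarrow> 'v graph \<Rightarrow> nat \<Rightarrow> bool" where
  "q_ramsey F G q \<longleftrightarrow>
     (\<forall>c :: 'w set \<Rightarrow> nat. c ` edges F \<subseteq> {1..q} \<longrightarrow>
        (\<exists>K. subgraph K F \<and> isomorphic G K \<and> (\<exists>i. \<forall>e\<in>edges K. c e = i)))"

text \<open>
  HOL cannot quantify over vertex types inside a definition. As every finite graph is isomorphic
  to one whose vertices are natural numbers, and being \<open>q\<close>-Ramsey is invariant under isomorphism,
  letting \<open>F\<close> range over graphs on natural numbers covers all finite graphs.
\<close>

definition ramsey_equivalent :: "nat \<Rightarrow> 'v graph \<Rightarrow> 'w graph \<Rightarrow> bool" where
  "ramsey_equivalent q H1 H2 \<longleftrightarrow>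
     (\<forall>F :: nat graph. is_graph F \<longrightarrow> (q_ramsey F H1 q \<longleftrightarrow> q_ramsey F H2 q))"

end

theory Submission
  imports Defs "HOL-Library.Countable" "HOL-Combinatorics.Transposition"
begin

text \<open>
  Let \<open>k\<close> be the chromatic number of \<open>G\<close>, \<open>\<kappa> = k - 1\<close> and \<open>s = a(G)\<close>. Words in \<open>[\<kappa>]\<^sup>q\<close>, with a pair of
  words having as its kind the first coordinate where they differ, form a complete graph whose edges
  fall into \<open>q\<close> kinds. Each kind is \<open>\<kappa>\<close>-colourable and contains \<open>K\<^bsub>\<kappa>\<^esub>\<close>, while any two kinds together contain
  \<open>K\<^bsub>k\<^esub>\<close> if \<open>\<kappa> \<ge> 2\<close> (if \<open>\<kappa> = 1\<close>, only the apex vertices matter). A partite construction based on the Hales--Jewett theorem gives a graph \<open>Y\<close> with \<open>q\<close> kinds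
  of edges all of whose small subgraphs map homomorphically to this template, such that in every
  edge colouring \<open>Y\<close> has a copy of a blow-up of the template on which the colour depends on the kind
  only.

  Join \<open>Y\<close> to \<open>q s\<close> independent apex vertices. In a \<open>q\<close>-colouring of the join, either two kinds
  share a colour, giving a monochromatic blow-up of \<open>K\<^bsub>k\<^esub>\<close>, or every colour occurs as a kind; then the most
  popular colour \<open>i\<close> among the apex vertices extends the blow-up of \<open>K\<^bsub>\<kappa>\<^esub>\<close> in colour \<open>i\<close> by a class of
  size \<open>s\<close>. In both cases there is a monochromatic \<open>G\<close>. Conversely, colour \<open>Y\<close> by kinds and give
  \<open>s\<close> apex vertices to every colour: a monochromatic copy of \<open>H\<close> would then be \<open>k\<close>-colourable with a class
  of size at most \<open>s\<close>.
\<close>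

section \<open>The Hales--Jewett theorem\<close>

definition words :: "'a set \<Rightarrow> nat \<Rightarrow> 'a list set" where
  "words A n = {w. set w \<subseteq> A \<and> length w = n}"

definition inst :: "'a \<Rightarrow> 'a option list \<Rightarrow> 'a list" where
  "inst a = map (case_option a id)"

text \<open>Combinatorial lines: \<open>None\<close> marks the moving coordinates, and at least one
  is required, so that a line never shrinks to a constant word.\<close>

definition line_templates :: "'a set \<Rightarrow> nat \<Rightarrow> 'a option list set" where
  "line_templates A n = {\<tau>. length \<tau> = n \<and> None \<in> set \<tau> \<and> (\<forall>a. Some a \<in> set \<tau> \<longrightarrow> a \<in> A)}"

lemma inst_append: "inst a (\<sigma> @ \<tau>) = inst a \<sigma> @ inst a \<tau>"
  by (simp add: inst_def)

lemma inst_map_Some: "inst a (map Some w) = w"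
  by (simp add: inst_def comp_def)

lemma inst_in_words: "\<tau> \<in> line_templates A n \<Longrightarrow> a \<in> A \<Longrightarrow> inst a \<tau> \<in> words A n"
  by (auto simp: inst_def line_templates_def words_def split: option.splits)

lemma line_templates_mono: "A \<subseteq> B \<Longrightarrow> line_templates A n \<subseteq> line_templates B n"
  by (auto simp: line_templates_def)

lemma words_mono: "A \<subseteq> B \<Longrightarrow> words A n \<subseteq> words B n"
  by (auto simp: words_def)

lemma words_append: "u \<in> words A m \<Longrightarrow> w \<in> words A n \<Longrightarrow> u @ w \<in> words A (m + n)"
  by (auto simp: words_def)

lemma line_templates_append:
  assumes "\<sigma> \<in> line_templates A m" "\<tau> \<in> line_templates A n"
  shows "\<sigma> @ \<tau> \<in> line_templates A (m + n)"
  using assms by (auto simp: line_templates_def)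

lemma line_templates_append_word:
  assumes "\<sigma> \<in> line_templates A m" "w \<in> words A n"
  shows "\<sigma> @ map Some w \<in> line_templates A (m + n)" "map Some w @ \<sigma> \<in> line_templates A (n + m)"
  using assms by (auto simp: line_templates_def words_def)

lemma finite_words: "finite A \<Longrightarrow> finite (words A n)"
  unfolding words_def by (rule finite_lists_length_eq)

lemma finite_line_templates:
  assumes "finite A" shows "finite (line_templates A n)"
proof (rule finite_subset)
  show "line_templates A n \<subseteq> {\<tau>. set \<tau> \<subseteq> insert None (Some ` A) \<and> length \<tau> = n}"
  proof clarify
    fix \<tau> assume t: "\<tau> \<in> line_templates A n"
    have "x \<in> insert None (Some ` A)" if "x \<in> set \<tau>" for x
      using t that by (cases x) (auto simp: line_templates_def)
    then show "set \<tau> \<subseteq> insert None (Some ` A) \<and> length \<tau> = n"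
      using t by (auto simp: line_templates_def)
  qed
  show "finite {\<tau>. set \<tau> \<subseteq> insert None (Some ` A) \<and> length \<tau> = n}"
    using assms by (intro finite_lists_length_eq) auto
qed

definition mono_line :: "'a set \<Rightarrow> nat \<Rightarrow> ('a list \<Rightarrow> 'c) \<Rightarrow> bool" where
  "mono_line A n c \<longleftrightarrow> (\<exists>\<tau>\<in>line_templates A n. \<exists>\<gamma>. \<forall>a\<in>A. c (inst a \<tau>) = \<gamma>)"

lemma mono_lineI:
  assumes "\<tau> \<in> line_templates A n" "\<And>a. a \<in> A \<Longrightarrow> c (inst a \<tau>) = \<gamma>"
  shows "mono_line A n c"
  using assms unfolding mono_line_def by blast

lemma mono_lineE:
  assumes "mono_line A n c"
  obtains \<tau> \<gamma> where "\<tau> \<in> line_templates A n" "\<forall>a\<in>A. c (inst a \<tau>) = \<gamma>"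
  using assms unfolding mono_line_def by blast

text \<open>Colour focusing: the lines are monochromatic as far as the letters of \<open>A\<close>
  are concerned, one line for each colour in \<open>\<Gamma>\<close>, and at the letter
  \<open>b\<close> they all pass through the same word \<open>f\<close>.\<close>

definition focused :: "'a set \<Rightarrow> 'a \<Rightarrow> nat \<Rightarrow> ('a list \<Rightarrow> 'c) \<Rightarrow> 'c set \<Rightarrow> bool" where
  "focused A b n c \<Gamma> \<longleftrightarrow> (\<exists>f\<in>words (insert b A) n. \<forall>\<gamma>\<in>\<Gamma>. \<exists>\<tau>\<in>line_templates (insert b A) n.
     inst b \<tau> = f \<and> (\<forall>a\<in>A. c (inst a \<tau>) = \<gamma>))"

text \<open>An injective recolouring keeps colours apart. The induction can thus be carried out for
  colours in \<open>nat\<close> and still be applied to colours that are functions.\<close>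

lemma mono_line_transfer:
  assumes inj: "inj_on h D"
    and mono: "mono_line A n (\<lambda>w. h (c w))"
    and c: "\<And>w. w \<in> words A n \<Longrightarrow> c w \<in> D"
    and ne: "A \<noteq> {}"
  shows "mono_line A n c"
proof -
  obtain a0 where a0: "a0 \<in> A" using ne by blast
  obtain \<tau> \<gamma> where t: "\<tau> \<in> line_templates A n" and g: "\<forall>a\<in>A. h (c (inst a \<tau>)) = \<gamma>"
    using mono by (rule mono_lineE)
  have "c (inst a \<tau>) = c (inst a0 \<tau>)" if "a \<in> A" for a
    using bspec[OF g that] bspec[OF g a0] inj c[OF inst_in_words[OF t that]] c[OF inst_in_words[OF t a0]]
    by (metis inj_onD)
  then show ?thesis using t by (blast intro: mono_lineI)
qed

text \<open>Induction on \<open>r\<close>: prepending a block to which Hales--Jewett for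
  \<open>A\<close> applies turns \<open>r\<close> focused lines into \<open>r + 1\<close>, unless a
  monochromatic line over \<open>insert b A\<close> appears.\<close>

lemma focusing_step:
  fixes C :: "nat set"
  assumes A: "finite A" "A \<noteq> {}" and C: "finite C"
    and HJ: "\<And>D::nat set. finite D \<Longrightarrow> \<exists>n. \<forall>c. c ` words A n \<subseteq> D \<longrightarrow> mono_line A n c"
  shows "\<exists>n. \<forall>c. c ` words (insert b A) n \<subseteq> C \<longrightarrow>
           mono_line (insert b A) n c \<or> (\<exists>\<Gamma>\<subseteq>C. card \<Gamma> = r \<and> focused A b n c \<Gamma>)"
proof (induction r)
  case 0
  show ?case
    by (intro exI[of _ 0] allI impI disjI2 exI[of _ "{}"]) (auto simp: focused_def words_def)
next
  case (Suc r)
  let ?B = "insert b A"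
  obtain n where n: "\<And>c. c ` words ?B n \<subseteq> C \<Longrightarrow>
      mono_line ?B n c \<or> (\<exists>\<Gamma>\<subseteq>C. card \<Gamma> = r \<and> focused A b n c \<Gamma>)"
    using Suc.IH by blast
  \<comment> \<open>A block of \<open>m\<close> letters is coloured by the whole colouring that it
    induces on the \<open>n\<close> letters behind it; \<open>h\<close> codes these functions as
    numbers, because \<open>HJ\<close> speaks of numerical colours.\<close>
  define D where "D = words ?B n \<rightarrow>\<^sub>E C"
  have "finite D" unfolding D_def using A C by (intro finite_PiE finite_words) auto
  then obtain h :: "('a list \<Rightarrow> nat) \<Rightarrow> nat" where h: "inj_on h D"
    using finite_imp_inj_to_nat_seg by metis
  obtain m where m: "\<And>c. c ` words A m \<subseteq> h ` D \<Longrightarrow> mono_line A m c"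
    using HJ[of "h ` D"] \<open>finite D\<close> by blast
  show ?case
  proof (intro exI[of _ "m + n"] allI impI)
    fix c :: "'a list \<Rightarrow> nat" assume c: "c ` words ?B (m + n) \<subseteq> C"
    define c' where "c' u = restrict (\<lambda>w. c (u @ w)) (words ?B n)" for u
    have c'D: "c' u \<in> D" if "u \<in> words A m" for u
      using that c words_append[of u ?B m _ n] words_mono[of A ?B m] by (auto simp: D_def c'_def)
    have "mono_line A m (\<lambda>w. h (c' w))" using c'D by (intro m) auto
    from mono_line_transfer[OF h this c'D A(2)]
  obtain \<sigma> g where \<sigma>: "\<sigma> \<in> line_templates A m" and g: "\<forall>a\<in>A. c' (inst a \<sigma>) = g"
      by (rule mono_lineE)
    obtain a0 where a0: "a0 \<in> A" using A by blast
    have \<sigma>B: "\<sigma> \<in> line_templates ?B m" using \<sigma> line_templates_mono[of A ?B m] by blast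
    \<comment> \<open>Along \<open>\<sigma>\<close> the induced colouring is the single function
      \<open>g\<close>, but this is guaranteed for letters of \<open>A\<close> only.\<close>
    have cg: "c (inst a \<sigma> @ w) = g w" if "a \<in> A" "w \<in> words ?B n" for a w
      using bspec[OF g that(1)] that(2) by (auto simp: c'_def)
    have "g \<in> D" using c'D[OF inst_in_words[OF \<sigma> a0]] bspec[OF g a0] by simp
    then have gC: "g ` words ?B n \<subseteq> C" by (auto simp: D_def)
    \<comment> \<open>Freezing the first block at a letter of \<open>A\<close> carries a line of
      \<open>g\<close> over to \<open>c\<close>.\<close>
    have lift: "mono_line ?B (m + n) c" if mono_g: "mono_line ?B n g"
    proof -
      obtain \<tau> \<gamma> where t: "\<tau> \<in> line_templates ?B n" "\<forall>a\<in>?B. g (inst a \<tau>) = \<gamma>"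
        using mono_g by (rule mono_lineE)
      have w: "inst a0 \<sigma> \<in> words ?B m" using inst_in_words[OF \<sigma>B] a0 by blast
      have "c (inst a (map Some (inst a0 \<sigma>) @ \<tau>)) = \<gamma>" if "a \<in> ?B" for a
        using bspec[OF t(2) that] cg[OF a0 inst_in_words[OF t(1) that]]
        by (simp add: inst_append inst_map_Some)
      with line_templates_append_word(2)[OF t(1) w] show ?thesis by (blast intro: mono_lineI)
    qed
    have "\<exists>\<Gamma>\<subseteq>C. card \<Gamma> = Suc r \<and> focused A b (m + n) c \<Gamma>" if no: "\<not> mono_line ?B (m + n) c"
    proof -
      obtain \<Gamma> where \<Gamma>: "\<Gamma> \<subseteq> C" "card \<Gamma> = r" "focused A b n g \<Gamma>"
        using n[OF gC] lift no by blast
      then obtain f where f: "f \<in> words ?B n" and foc: "\<And>\<gamma>. \<gamma> \<in> \<Gamma> \<Longrightarrow>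
          \<exists>\<tau>\<in>line_templates ?B n. inst b \<tau> = f \<and> (\<forall>a\<in>A. g (inst a \<tau>) = \<gamma>)"
        by (auto simp: focused_def)
      \<comment> \<open>If the focus had one of the old colours, the line of that colour would stay
        monochromatic at \<open>b\<close>.\<close>
      have new: "g f \<notin> \<Gamma>"
      proof
        assume "g f \<in> \<Gamma>"
        then have "mono_line ?B n g" using foc by (fastforce simp: mono_line_def)
        then show False using lift no by blast
      qed
      \<comment> \<open>The line of the new colour moves in the first block only, those of the old
        colours move in both blocks, so all of them end in
        \<open>inst b \<sigma> @ f\<close>.\<close>
      have "\<exists>\<tau>\<in>line_templates ?B (m + n). inst b \<tau> = inst b \<sigma> @ f \<and> (\<forall>a\<in>A. c (inst a \<tau>) = \<gamma>)"
        if "\<gamma> \<in> insert (g f) \<Gamma>" for \<gamma>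
      proof (cases "\<gamma> = g f")
        case True
        show ?thesis
          using line_templates_append_word(1)[OF \<sigma>B f] cg[OF _ f] True
          by (intro bexI[of _ "\<sigma> @ map Some f"]) (auto simp: inst_append inst_map_Some)
      next
        case False
        then obtain \<tau> where t: "\<tau> \<in> line_templates ?B n" "inst b \<tau> = f" "\<forall>a\<in>A. g (inst a \<tau>) = \<gamma>"
          using foc \<open>\<gamma> \<in> insert (g f) \<Gamma>\<close> by blast
        show ?thesis
          using line_templates_append[OF \<sigma>B t(1)] t cg[OF _ inst_in_words[OF t(1)]]
          by (intro bexI[of _ "\<sigma> @ \<tau>"]) (auto simp: inst_append)
      qed
      moreover have "inst b \<sigma> @ f \<in> words ?B (m + n)"
        using words_append[OF inst_in_words[OF \<sigma>B] f] by blast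
      ultimately have "focused A b (m + n) c (insert (g f) \<Gamma>)"
        unfolding focused_def by blast
      moreover have "card (insert (g f) \<Gamma>) = Suc r"
        using new \<Gamma> C by (simp add: finite_subset)
      moreover have "g f \<in> C" using gC f by blast
      ultimately show ?thesis
        using \<Gamma>(1) by blast
    qed
    then show "mono_line ?B (m + n) c \<or> (\<exists>\<Gamma>\<subseteq>C. card \<Gamma> = Suc r \<and> focused A b (m + n) c \<Gamma>)"
      by blast
  qed
qed

lemma hales_jewett_nat:
  fixes C :: "nat set"
  assumes "finite A" "A \<noteq> {}" "finite C"
  shows "\<exists>n. \<forall>c. c ` words A n \<subseteq> C \<longrightarrow> mono_line A n c"
  using assms
proof (induction A arbitrary: C rule: finite_ne_induct)
  case (singleton x)
  have "[None] \<in> line_templates {x} 1" by (auto simp: line_templates_def)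
  then show ?case by (auto simp: mono_line_def)
next
  case (insert b A)
  \<comment> \<open>There cannot be more focused lines than colours, so for
    \<open>r = Suc (card C)\<close> only the monochromatic line is left.\<close>
  have "\<not> (\<exists>\<Gamma>\<subseteq>C. card \<Gamma> = Suc (card C) \<and> P \<Gamma>)" for P
    using card_mono[OF insert.prems] by (metis Suc_n_not_le_n)
  then show ?case
    using focusing_step[OF insert.hyps(1,2) insert.prems insert.IH, of b "Suc (card C)"] by metis
qed

theorem hales_jewett:
  assumes "finite A" "A \<noteq> {}" "finite C"
  shows "\<exists>n. \<forall>c. c ` words A n \<subseteq> C \<longrightarrow> mono_line A n c"
proof -
  obtain h :: "'b \<Rightarrow> nat" where h: "inj_on h C"
    using assms(3) finite_imp_inj_to_nat_seg by metis
  obtain n where n: "\<And>c. c ` words A n \<subseteq> h ` C \<Longrightarrow> mono_line A n c"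
    using hales_jewett_nat[OF assms(1,2), of "h ` C"] assms(3) by blast
  have "mono_line A n c" if "c ` words A n \<subseteq> C" for c
    using that assms by (intro mono_line_transfer[OF h n]) auto
  then show ?thesis by blast
qed

section \<open>Partite amalgamation\<close>

text \<open>Two lines meeting in a pair outside the alphabet coincide. Hence distinct copies in the amalgam
  below that share a vertex on either side share an edge.\<close>

lemma inst_eq_cases:
  assumes \<sigma>: "\<sigma> \<in> line_templates A n" and \<tau>: "\<tau> \<in> line_templates A n"
    and eq: "inst p \<sigma> = inst r \<tau>"
  shows "\<sigma> = \<tau> \<or> p \<in> A \<and> r \<in> A"
proof -
  have *: "\<alpha> = \<beta>" if a: "\<alpha> \<in> line_templates A n" and b: "\<beta> \<in> line_templates A n"
    and eq: "inst p \<alpha> = inst r \<beta>" and p: "p \<notin> A" for \<alpha> \<beta> p r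
  proof -
    have len: "length \<alpha> = n" "length \<beta> = n" using a b by (auto simp: line_templates_def)
    have pos: "case_option p id (\<alpha> ! j) = case_option r id (\<beta> ! j)" if "j < n" for j
      using arg_cong[OF eq, of "\<lambda>l. l ! j"] that len by (simp add: inst_def)
    have mem: "\<alpha> ! j = Some z \<Longrightarrow> z \<in> A" "\<beta> ! j = Some z \<Longrightarrow> z \<in> A" if "j < n" for j z
      using a b len that by (auto simp: line_templates_def) (metis nth_mem)+
    \<comment> \<open>A moving coordinate shows \<open>p\<close>, which lies outside the alphabet
      and so cannot be a constant of the other template.\<close>
    have none: "\<beta> ! j = None" if "j < n" "\<alpha> ! j = None" for j
      using pos[OF that(1)] mem(2)[OF that(1)] that(2) p by (cases "\<beta> ! j") auto
    obtain j0 where "j0 < n" "\<alpha> ! j0 = None"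
      using a len by (auto simp: line_templates_def in_set_conv_nth)
    then have "r = p" using pos[of j0] none[of j0] by simp
    have "\<alpha> ! j = \<beta> ! j" if "j < n" for j
      using pos[OF that] mem[OF that] none[OF that] p \<open>r = p\<close>
      by (cases "\<alpha> ! j"; cases "\<beta> ! j") auto
    then show ?thesis using len by (simp add: list_eq_iff_nth_eq)
  qed
  show ?thesis using *[OF \<sigma> \<tau> eq] *[OF \<tau> \<sigma> eq[symmetric]] by auto
qed

text \<open>Edges are triples of a kind and two ends, so one pair may carry several kinds. Only
  edges inside \<open>S\<close> are constrained.\<close>

definition hom_on :: "'v set \<Rightarrow> (nat \<times> 'v \<times> 'v) set \<Rightarrow> 'u set \<Rightarrow> (nat \<Rightarrow> 'u \<Rightarrow> 'u \<Rightarrow> bool) \<Rightarrow> ('v \<Rightarrow> 'u) \<Rightarrow> bool"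
  where "hom_on S D U R \<psi> \<longleftrightarrow> \<psi> ` S \<subseteq> U \<and>
    (\<forall>i x y. (i, x, y) \<in> D \<longrightarrow> x \<in> S \<longrightarrow> y \<in> S \<longrightarrow> R i (\<psi> x) (\<psi> y))"

text \<open>A transversal meets each fibre of \<open>\<pi>\<close> at most once. The homomorphism
  may depend on the transversal.\<close>

definition transversals_hom ::
  "'v set \<Rightarrow> (nat \<times> 'v \<times> 'v) set \<Rightarrow> ('v \<Rightarrow> 'w) \<Rightarrow> 'u set \<Rightarrow> (nat \<Rightarrow> 'u \<Rightarrow> 'u \<Rightarrow> bool) \<Rightarrow> bool"
  where "transversals_hom W D \<pi> U R \<longleftrightarrow> (\<forall>S\<subseteq>W. inj_on \<pi> S \<longrightarrow> (\<exists>\<psi>. hom_on S D U R \<psi>))"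

text \<open>Enough symmetry to prescribe where a homomorphism sends one vertex or one edge. The maps
  \<open>\<sigma>\<close> need only be endomorphisms of the template.\<close>

locale homogeneous_template =
  fixes U :: "'u set" and R :: "nat \<Rightarrow> 'u \<Rightarrow> 'u \<Rightarrow> bool"
  assumes nonempty: "U \<noteq> {}"
    and vertex_transitive: "\<And>u v. u \<in> U \<Longrightarrow> v \<in> U \<Longrightarrow>
      \<exists>\<sigma>. \<sigma> u = v \<and> \<sigma> ` U \<subseteq> U \<and> (\<forall>i. \<forall>x\<in>U. \<forall>y\<in>U. R i x y \<longrightarrow> R i (\<sigma> x) (\<sigma> y))"
    and edge_transitive: "\<And>j u v u' v'. u \<in> U \<Longrightarrow> v \<in> U \<Longrightarrow> u' \<in> U \<Longrightarrow> v' \<in> U \<Longrightarrow>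
      R j u v \<Longrightarrow> R j u' v' \<Longrightarrow>
      \<exists>\<sigma>. \<sigma> u = u' \<and> \<sigma> v = v' \<and> \<sigma> ` U \<subseteq> U \<and>
          (\<forall>i. \<forall>x\<in>U. \<forall>y\<in>U. R i x y \<longrightarrow> R i (\<sigma> x) (\<sigma> y))"
begin

lemma hom_on_compose:
  assumes "hom_on S D U R \<psi>" "\<sigma> ` U \<subseteq> U" "\<forall>i. \<forall>x\<in>U. \<forall>y\<in>U. R i x y \<longrightarrow> R i (\<sigma> x) (\<sigma> y)"
  shows "hom_on S D U R (\<sigma> \<circ> \<psi>)"
  using assms unfolding hom_on_def by (auto simp: image_subset_iff)

lemma hom_on_move_vertex:
  assumes "hom_on S D U R \<psi>" "x \<in> S" "u \<in> U"
  obtains \<phi> where "hom_on S D U R \<phi>" "\<phi> x = u"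
proof -
  have "\<psi> x \<in> U" using assms by (auto simp: hom_on_def)
  from vertex_transitive[OF this assms(3)] obtain \<sigma> where "\<sigma> (\<psi> x) = u" "\<sigma> ` U \<subseteq> U"
    "\<forall>i. \<forall>x\<in>U. \<forall>y\<in>U. R i x y \<longrightarrow> R i (\<sigma> x) (\<sigma> y)" by blast
  with that[of "\<sigma> \<circ> \<psi>"] hom_on_compose[OF assms(1)] show ?thesis by simp
qed

lemma hom_on_move_edge:
  assumes "hom_on S D U R \<psi>" "x \<in> S" "y \<in> S" "(j, x, y) \<in> D" "u \<in> U" "v \<in> U" "R j u v"
  obtains \<phi> where "hom_on S D U R \<phi>" "\<phi> x = u" "\<phi> y = v"
proof -
  have "\<psi> x \<in> U" "\<psi> y \<in> U" "R j (\<psi> x) (\<psi> y)" using assms by (auto simp: hom_on_def)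
  from edge_transitive[OF this(1,2) assms(5,6) this(3) assms(7)]
  obtain \<sigma> where "\<sigma> (\<psi> x) = u" "\<sigma> (\<psi> y) = v" "\<sigma> ` U \<subseteq> U"
    "\<forall>i. \<forall>x\<in>U. \<forall>y\<in>U. R i x y \<longrightarrow> R i (\<sigma> x) (\<sigma> y)" by blast
  with that[of "\<sigma> \<circ> \<psi>"] hom_on_compose[OF assms(1)] show ?thesis by simp
qed

text \<open>The copies of \<open>W\<close> are glued along the bipartite graph of words over the edges between the
  fibres of \<open>a\<close> and \<open>b\<close>. A transversal meets that part in at most one vertex on each side, so the
  homomorphisms on the copies agree there after composition with symmetries of the template.\<close>

lemma partite_amalgam:
  fixes \<pi> :: "nat \<Rightarrow> nat"
  assumes finW: "finite W" and finD: "finite D" and DW: "D \<subseteq> UNIV \<times> W \<times> W" and "a \<noteq> b"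
    and trans: "transversals_hom W D \<pi> U R" and C: "finite C"
  shows "\<exists>(W' :: nat set) D' \<pi>'. finite W' \<and> finite D' \<and> D' \<subseteq> UNIV \<times> W' \<times> W' \<and>
    \<pi>' ` W' \<subseteq> \<pi> ` W \<and>
    (\<forall>i x y. (i, x, y) \<in> D' \<longrightarrow> (\<exists>x0 y0. (i, x0, y0) \<in> D \<and> \<pi>' x = \<pi> x0 \<and> \<pi>' y = \<pi> y0)) \<and>
    transversals_hom W' D' \<pi>' U R \<and>
    (\<forall>c. (\<forall>e. c e \<in> C) \<longrightarrow> (\<exists>\<iota>. inj_on \<iota> W \<and> \<iota> ` W \<subseteq> W' \<and>
      (\<forall>i x y. (i, x, y) \<in> D \<longrightarrow> (i, \<iota> x, \<iota> y) \<in> D') \<and> (\<forall>x\<in>W. \<pi>' (\<iota> x) = \<pi> x) \<and>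
      (\<exists>\<gamma>. \<forall>x y. (j, x, y) \<in> D \<longrightarrow> \<pi> x = a \<longrightarrow> \<pi> y = b \<longrightarrow> c (j, \<iota> x, \<iota> y) = \<gamma>)))"
proof -
  \<comment> \<open>The alphabet for Hales--Jewett: the edges of kind \<open>j\<close> between the
    two fibres, which are to become monochromatic in some copy.\<close>
  define A where "A = {(x, y). (j, x, y) \<in> D \<and> \<pi> x = a \<and> \<pi> y = b}"
  have "A \<subseteq> W \<times> W" using DW by (auto simp: A_def)
  then have "finite A" using finW finite_subset by blast
  show ?thesis
  proof (cases "A = {}")
    case True
    then have "\<not> ((j, x, y) \<in> D \<and> \<pi> x = a \<and> \<pi> y = b)" for x y by (auto simp: A_def)
    then show ?thesis
      using assms by (intro exI[of _ W] exI[of _ D] exI[of _ \<pi>] conjI allI impI exI[of _ "\<lambda>x. x"]) auto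
  next
    case False
    from hales_jewett[OF \<open>finite A\<close> False C] obtain n where
      n: "\<forall>c. c ` words A n \<subseteq> C \<longrightarrow> mono_line A n c" by blast
    define T where "T = line_templates A n"
    have finT: "finite T" unfolding T_def using \<open>finite A\<close> by (rule finite_line_templates)
    define wd :: "bool \<Rightarrow> nat list \<Rightarrow> nat" where
      "wd s l = to_nat (Inl (s, l) :: bool \<times> nat list + (nat \<times> nat) option list \<times> nat)" for s l
    define ot :: "(nat \<times> nat) option list \<Rightarrow> nat \<Rightarrow> nat" where
      "ot \<tau> w = to_nat (Inr (\<tau>, w) :: bool \<times> nat list + (nat \<times> nat) option list \<times> nat)" for \<tau> w
    \<comment> \<open>\<open>\<iota> \<tau>\<close> is the copy of \<open>W\<close> along the line
      \<open>\<tau>\<close>. A vertex over \<open>a\<close> or \<open>b\<close> becomes a word, with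
      itself in the moving places and ends of edges of \<open>A\<close> in the fixed ones; all other
      vertices are tagged with \<open>\<tau>\<close> and so are private to the copy.\<close>
    define \<iota> where "\<iota> \<tau> w = (if \<pi> w = a then wd False (map (case_option w fst) \<tau>)
      else if \<pi> w = b then wd True (map (case_option w snd) \<tau>) else ot \<tau> w)" for \<tau> w
    have wd_inject: "wd s l = wd s' l' \<longleftrightarrow> s = s' \<and> l = l'" for s l s' l' by (simp add: wd_def)
    have ot_inject: "ot s l = ot s' l' \<longleftrightarrow> s = s' \<and> l = l'" for s l s' l' by (simp add: ot_def)
    have [simp]: "wd s l \<noteq> ot \<tau> w" "ot \<tau> w \<noteq> wd s l" for s l \<tau> w by (simp_all add: wd_def ot_def)
    define \<pi>' where "\<pi>' v = (case from_nat v :: bool \<times> nat list + (nat \<times> nat) option list \<times> nat of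
      Inl (s, l) \<Rightarrow> if s then b else a | Inr (\<tau>, w) \<Rightarrow> \<pi> w)" for v
    have \<pi>'\<iota>: "\<pi>' (\<iota> \<tau> w) = \<pi> w" for \<tau> w
      by (auto simp: \<iota>_def \<pi>'_def wd_def ot_def)
    have inj\<iota>: "\<iota> \<tau> w = \<iota> \<tau> w' \<Longrightarrow> w = w'" if \<tau>: "\<tau> \<in> T" for \<tau> w w'
    proof -
      assume eq: "\<iota> \<tau> w = \<iota> \<tau> w'"
      have "None \<in> set \<tau>" using \<tau> by (auto simp: T_def line_templates_def)
      then have "map (case_option w h) \<tau> = map (case_option w' h) \<tau> \<Longrightarrow> w = w'" for h :: "nat \<times> nat \<Rightarrow> nat"
        by (auto dest: bspec)
      moreover have "\<pi> w = \<pi> w'" using eq \<pi>'\<iota> by metis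
      ultimately show "w = w'" using eq by (auto simp: \<iota>_def wd_inject ot_inject split: if_splits)
    qed
    have map_proj: "map fst (inst (x, y) \<rho>) = map (case_option x fst) \<rho>"
         "map snd (inst (x, y) \<rho>) = map (case_option y snd) \<rho>"
      for \<rho> :: "(nat \<times> nat) option list" and x y
      by (auto simp: inst_def split: option.splits)
    \<comment> \<open>Left and right words together recover the word of pairs, so agreement of two
      copies on both sides makes their lines meet.\<close>
    have sharing: "\<sigma> = \<tau> \<or> (j, x, y) \<in> D \<and> (j, x', y') \<in> D"
      if "\<sigma> \<in> T" "\<tau> \<in> T" "\<pi> x = a" "\<pi> y = b" "\<pi> x' = a" "\<pi> y' = b"
        and eq: "\<iota> \<sigma> x = \<iota> \<tau> x'" "\<iota> \<sigma> y = \<iota> \<tau> y'" for \<sigma> \<tau> x y x' y'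
    proof -
      have "map fst (inst (x, y) \<sigma>) = map fst (inst (x', y') \<tau>)"
           "map snd (inst (x, y) \<sigma>) = map snd (inst (x', y') \<tau>)"
        using eq that \<open>a \<noteq> b\<close> unfolding map_proj by (auto simp: \<iota>_def wd_inject)
      then have "inst (x, y) \<sigma> = inst (x', y') \<tau>" by (metis zip_map_fst_snd)
      from inst_eq_cases[OF that(1,2)[unfolded T_def] this] show ?thesis by (auto simp: A_def)
    qed
    define W' where "W' = (\<Union>\<tau>\<in>T. \<iota> \<tau> ` W)"
    define D' where "D' = (\<Union>\<tau>\<in>T. (\<lambda>(i, x, y). (i, \<iota> \<tau> x, \<iota> \<tau> y)) ` D)"
    have D'E: "\<exists>\<tau>\<in>T. \<exists>x0 y0. (i, x0, y0) \<in> D \<and> x = \<iota> \<tau> x0 \<and> y = \<iota> \<tau> y0" if "(i, x, y) \<in> D'" for i x y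
      using that by (auto simp: D'_def)
    have th: "transversals_hom W' D' \<pi>' U R"
      unfolding transversals_hom_def
    proof (intro allI impI)
      fix S assume S: "S \<subseteq> W'" and injS: "inj_on \<pi>' S"
      define pre where "pre \<tau> = {w \<in> W. \<iota> \<tau> w \<in> S}" for \<tau>
      have same: "\<iota> \<sigma> w = \<iota> \<tau> w'" if "w \<in> pre \<sigma>" "w' \<in> pre \<tau>" "\<pi> w = \<pi> w'" for \<sigma> \<tau> w w'
        by (rule inj_onD[OF injS]) (use that \<pi>'\<iota> in \<open>auto simp: pre_def\<close>)
      have injpre: "inj_on \<pi> (pre \<tau>)" if "\<tau> \<in> T" for \<tau>
        using inj\<iota>[OF that] same by (intro inj_onI) blast
      have ex: "\<exists>\<psi>. hom_on (pre \<tau>) D U R \<psi>" if "\<tau> \<in> T" for \<tau>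
        using trans injpre[OF that] by (simp add: transversals_hom_def pre_def)
      \<comment> \<open>Copies overlap only over \<open>a\<close> and \<open>b\<close>, where the
        images \<open>u\<close> and \<open>v\<close> are fixed in advance; elsewhere distinct copies
        are disjoint. Homomorphisms that fit can therefore be glued.\<close>
      define fits where "fits u v \<tau> \<psi> \<longleftrightarrow> hom_on (pre \<tau>) D U R \<psi> \<and>
        (\<forall>w\<in>pre \<tau>. (\<pi> w = a \<longrightarrow> \<psi> w = u) \<and> (\<pi> w = b \<longrightarrow> \<psi> w = v))" for u v \<tau> \<psi>
      define both where "both \<tau> x y \<longleftrightarrow> \<tau> \<in> T \<and> x \<in> pre \<tau> \<and> y \<in> pre \<tau> \<and> \<pi> x = a \<and> \<pi> y = b" for \<tau> x y
      have uniq: "w = w'" if "\<tau> \<in> T" "w \<in> pre \<tau>" "w' \<in> pre \<tau>" "\<pi> w = \<pi> w'" for \<tau> w w'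
        using injpre[OF that(1)] that by (auto dest: inj_onD)
      have single: "\<exists>\<psi>. fits u v \<tau> \<psi>"
        if \<tau>: "\<tau> \<in> T" and no: "\<nexists>x y. both \<tau> x y" and u: "u \<in> U" and v: "v \<in> U" for u v \<tau>
      proof -
        obtain \<psi> where \<psi>: "hom_on (pre \<tau>) D U R \<psi>" using ex[OF \<tau>] by blast
        consider x where "x \<in> pre \<tau>" "\<pi> x = a" | y where "y \<in> pre \<tau>" "\<pi> y = b"
          | "\<forall>w\<in>pre \<tau>. \<pi> w \<noteq> a \<and> \<pi> w \<noteq> b" by blast
        then show ?thesis
        proof cases
          case 1
          obtain \<phi> where "hom_on (pre \<tau>) D U R \<phi>" "\<phi> x = u"
            using hom_on_move_vertex[OF \<psi> 1(1) u] .
          moreover have "\<pi> w \<noteq> b" if "w \<in> pre \<tau>" for w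
            using no 1 \<tau> that unfolding both_def by blast
          moreover have "w = x" if "w \<in> pre \<tau>" "\<pi> w = a" for w
            using uniq[OF \<tau> that(1) 1(1)] that(2) 1(2) by simp
          ultimately have "fits u v \<tau> \<phi>" unfolding fits_def by blast
          then show ?thesis by blast
        next
          case 2
          obtain \<phi> where "hom_on (pre \<tau>) D U R \<phi>" "\<phi> y = v"
            using hom_on_move_vertex[OF \<psi> 2(1) v] .
          moreover have "\<pi> w \<noteq> a" if "w \<in> pre \<tau>" for w
            using no 2 \<tau> that unfolding both_def by blast
          moreover have "w = y" if "w \<in> pre \<tau>" "\<pi> w = b" for w
            using uniq[OF \<tau> that(1) 2(1)] that(2) 2(2) by simp
          ultimately have "fits u v \<tau> \<phi>" unfolding fits_def by blast
          then show ?thesis by blast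
        next
          case 3
          then show ?thesis using \<psi> unfolding fits_def by blast
        qed
      qed
      \<comment> \<open>A copy that sees \<open>S\<close> on both sides, if there is one, dictates
        \<open>u\<close> and \<open>v\<close>; otherwise any template vertices will do.\<close>
      have "\<exists>u v. \<forall>\<tau>\<in>T. \<exists>\<psi>. fits u v \<tau> \<psi>"
      proof (cases "\<exists>\<tau> x y. both \<tau> x y")
        case False
        then show ?thesis using single nonempty by blast
      next
        case True
        then obtain \<tau>0 x0 y0 where 0: "both \<tau>0 x0 y0" by blast
        then have \<tau>0: "\<tau>0 \<in> T" "x0 \<in> pre \<tau>0" "y0 \<in> pre \<tau>0" "\<pi> x0 = a" "\<pi> y0 = b"
          by (auto simp: both_def)
        obtain \<psi>0 where \<psi>0: "hom_on (pre \<tau>0) D U R \<psi>0" using ex[OF \<tau>0(1)] by blast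
        then have U0: "\<psi>0 x0 \<in> U" "\<psi>0 y0 \<in> U" using \<tau>0 by (auto simp: hom_on_def)
        have "\<exists>\<psi>. fits (\<psi>0 x0) (\<psi>0 y0) \<tau> \<psi>" if \<tau>: "\<tau> \<in> T" for \<tau>
        proof (cases "\<exists>x y. both \<tau> x y")
          case False
          then show ?thesis using single[OF \<tau> _ U0] by blast
        next
          case True
          then obtain x y where xy: "x \<in> pre \<tau>" "y \<in> pre \<tau>" "\<pi> x = a" "\<pi> y = b"
            by (auto simp: both_def)
          have fitsI: "fits (\<psi>0 x0) (\<psi>0 y0) \<tau> \<psi>"
            if "hom_on (pre \<tau>) D U R \<psi>" "\<psi> x = \<psi>0 x0" "\<psi> y = \<psi>0 y0" for \<psi>
          proof -
            have "w = x" if "w \<in> pre \<tau>" "\<pi> w = a" for w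
              using uniq[OF \<tau> that(1) xy(1)] that(2) xy(3) by simp
            moreover have "w = y" if "w \<in> pre \<tau>" "\<pi> w = b" for w
              using uniq[OF \<tau> that(1) xy(2)] that(2) xy(4) by simp
            ultimately show ?thesis using that unfolding fits_def by blast
          qed
          have "\<iota> \<tau> x = \<iota> \<tau>0 x0" "\<iota> \<tau> y = \<iota> \<tau>0 y0" 
            using same[OF xy(1) \<tau>0(2)] same[OF xy(2) \<tau>0(3)] xy \<tau>0 by simp_all
          from sharing[OF \<tau> \<tau>0(1) xy(3,4) \<tau>0(4,5) this]
          show ?thesis
          proof
            assume "\<tau> = \<tau>0"
            moreover have "x = x0" "y = y0" 
              using uniq[OF \<tau> xy(1), of x0] uniq[OF \<tau> xy(2), of y0] xy \<tau>0 \<open>\<tau> = \<tau>0\<close> by simp_all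
            ultimately show ?thesis using fitsI[of \<psi>0] \<psi>0 by blast
          next
            assume D: "(j, x, y) \<in> D \<and> (j, x0, y0) \<in> D"
            \<comment> \<open>Both pairs are edges of kind \<open>j\<close>, so edge transitivity
              moves a homomorphism on \<open>pre \<tau>\<close> to the prescribed images.\<close>
            then have "R j (\<psi>0 x0) (\<psi>0 y0)" using \<psi>0 \<tau>0 by (auto simp: hom_on_def)
            obtain \<psi> where "hom_on (pre \<tau>) D U R \<psi>" using ex[OF \<tau>] by blast
            then obtain \<phi> where "hom_on (pre \<tau>) D U R \<phi>" "\<phi> x = \<psi>0 x0" "\<phi> y = \<psi>0 y0"
              using hom_on_move_edge[OF _ xy(1,2) conjunct1[OF D] U0 \<open>R j _ _\<close>] by blast
            then show ?thesis using fitsI by blast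
          qed
        qed
        then show ?thesis by blast
      qed
      then obtain u v where "\<forall>\<tau>\<in>T. \<exists>\<psi>. fits u v \<tau> \<psi>" by blast
      then obtain \<Psi> where \<Psi>: "\<And>\<tau>. \<tau> \<in> T \<Longrightarrow> fits u v \<tau> (\<Psi> \<tau>)" by metis
      define \<psi> where "\<psi> s = (case from_nat s :: bool \<times> nat list + (nat \<times> nat) option list \<times> nat of
        Inl (t, l) \<Rightarrow> if t then v else u | Inr (\<tau>, w) \<Rightarrow> \<Psi> \<tau> w)" for s
      have \<psi>\<iota>: "\<psi> (\<iota> \<tau> w) = \<Psi> \<tau> w" if "\<tau> \<in> T" "w \<in> pre \<tau>" for \<tau> w
        using \<Psi>[OF that(1)] that(2) by (auto simp: \<psi>_def \<iota>_def wd_def ot_def fits_def)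
      have "hom_on S D' U R \<psi>"
        unfolding hom_on_def
      proof (intro conjI allI impI subsetI)
        fix r assume "r \<in> \<psi> ` S"
        then obtain s where s: "s \<in> S" "r = \<psi> s" by blast
        then obtain \<tau> w where w: "\<tau> \<in> T" "w \<in> W" "s = \<iota> \<tau> w" using S by (auto simp: W'_def)
        then have "w \<in> pre \<tau>" using s by (auto simp: pre_def)
        then show "r \<in> U" using \<psi>\<iota>[OF w(1)] \<Psi>[OF w(1)] s w by (auto simp: fits_def hom_on_def)
      next
        fix i s s' assume "(i, s, s') \<in> D'" and ss: "s \<in> S" "s' \<in> S"
        from D'E[OF this(1)] obtain \<tau> x y where w: "\<tau> \<in> T" "(i, x, y) \<in> D" "s = \<iota> \<tau> x" "s' = \<iota> \<tau> y"
          by blast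
        then have "x \<in> pre \<tau>" "y \<in> pre \<tau>" using ss DW by (auto simp: pre_def)
        then show "R i (\<psi> s) (\<psi> s')"
          using \<psi>\<iota>[OF w(1)] \<Psi>[OF w(1)] w by (auto simp: fits_def hom_on_def)
      qed
      then show "\<exists>\<psi>. hom_on S D' U R \<psi>" by blast
    qed
    have ramsey: "\<forall>c. (\<forall>e. c e \<in> C) \<longrightarrow> (\<exists>\<iota>. inj_on \<iota> W \<and> \<iota> ` W \<subseteq> W' \<and>
      (\<forall>i x y. (i, x, y) \<in> D \<longrightarrow> (i, \<iota> x, \<iota> y) \<in> D') \<and> (\<forall>x\<in>W. \<pi>' (\<iota> x) = \<pi> x) \<and>
      (\<exists>\<gamma>. \<forall>x y. (j, x, y) \<in> D \<longrightarrow> \<pi> x = a \<longrightarrow> \<pi> y = b \<longrightarrow> c (j, \<iota> x, \<iota> y) = \<gamma>))"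
    proof (intro allI impI)
      fix c :: "nat \<times> nat \<times> nat \<Rightarrow> _" assume c: "\<forall>e. c e \<in> C"
      \<comment> \<open>A word over \<open>A\<close> names the pair of its left and right words. A
        monochromatic line is then a copy of \<open>W\<close> in which the edges from
        \<open>A\<close> have a single colour.\<close>
      have "mono_line A n (\<lambda>w. c (j, wd False (map fst w), wd True (map snd w)))"
        using c by (intro n[rule_format]) auto
      then obtain \<tau> \<gamma> where \<tau>: "\<tau> \<in> line_templates A n" and
        \<gamma>: "\<forall>p\<in>A. c (j, wd False (map fst (inst p \<tau>)), wd True (map snd (inst p \<tau>))) = \<gamma>"
        by (rule mono_lineE)
      have m: "c (j, \<iota> \<tau> x, \<iota> \<tau> y) = \<gamma>" if "(j, x, y) \<in> D" "\<pi> x = a" "\<pi> y = b" for x y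
        using bspec[OF \<gamma>, of "(x, y)"] that \<open>a \<noteq> b\<close> by (simp add: A_def \<iota>_def map_proj)
      have "inj_on (\<iota> \<tau>) W" using inj\<iota> \<tau> by (auto simp: T_def intro: inj_onI)
      moreover have "\<iota> \<tau> ` W \<subseteq> W'" using \<tau> by (auto simp: W'_def T_def)
      moreover have "(i, \<iota> \<tau> x, \<iota> \<tau> y) \<in> D'" if "(i, x, y) \<in> D" for i x y
        using \<tau> that by (force simp: D'_def T_def)
      ultimately show "\<exists>\<iota>. inj_on \<iota> W \<and> \<iota> ` W \<subseteq> W' \<and>
        (\<forall>i x y. (i, x, y) \<in> D \<longrightarrow> (i, \<iota> x, \<iota> y) \<in> D') \<and> (\<forall>x\<in>W. \<pi>' (\<iota> x) = \<pi> x) \<and>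
        (\<exists>\<gamma>. \<forall>x y. (j, x, y) \<in> D \<longrightarrow> \<pi> x = a \<longrightarrow> \<pi> y = b \<longrightarrow> c (j, \<iota> x, \<iota> y) = \<gamma>)"
        using \<pi>'\<iota> m by (intro exI[of _ "\<iota> \<tau>"] exI[of _ \<gamma>] conjI) simp_all
    qed
    have fin: "finite W'" "finite D'" using finT finW finD by (auto simp: W'_def D'_def)
    have sub: "D' \<subseteq> UNIV \<times> W' \<times> W'" "\<pi>' ` W' \<subseteq> \<pi> ` W"
      using DW \<pi>'\<iota> by (force simp: W'_def D'_def)+
    have proj: "\<forall>i x y. (i, x, y) \<in> D' \<longrightarrow>
        (\<exists>x0 y0. (i, x0, y0) \<in> D \<and> \<pi>' x = \<pi> x0 \<and> \<pi>' y = \<pi> y0)"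
      using D'E \<pi>'\<iota> by metis
    show ?thesis
      by (intro exI[of _ W'] exI[of _ D'] exI[of _ \<pi>'] conjI fin sub proj th ramsey)
  qed
qed

end

section \<open>The partite construction\<close>

text \<open>The pattern is an ordered blow-up of the template: position \<open>x\<close> lies in the
  class of \<open>\<eta> x\<close>, and edges run upwards. The colour may depend on the kind of an
  edge but not on its position.\<close>

definition uniform_copy ::
  "nat \<Rightarrow> nat set \<Rightarrow> (nat \<Rightarrow> 'u) \<Rightarrow> (nat \<Rightarrow> 'u \<Rightarrow> 'u \<Rightarrow> bool) \<Rightarrow>
    'v set \<Rightarrow> (nat \<times> 'v \<times> 'v) set \<Rightarrow> (nat \<times> 'v \<times> 'v \<Rightarrow> 'c) \<Rightarrow> (nat \<Rightarrow> 'v) \<Rightarrow> (nat \<Rightarrow> 'c) \<Rightarrow> bool"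
  where "uniform_copy M I \<eta> R V E c f \<gamma> \<longleftrightarrow> inj_on f {..<M} \<and> f ` {..<M} \<subseteq> V \<and>
    (\<forall>x y. \<forall>i\<in>I. x < y \<longrightarrow> y < M \<longrightarrow> R i (\<eta> x) (\<eta> y) \<longrightarrow> (i, f x, f y) \<in> E \<and> c (i, f x, f y) = \<gamma> i)"

definition pattern_ramsey ::
  "nat \<Rightarrow> nat set \<Rightarrow> (nat \<Rightarrow> 'u) \<Rightarrow> (nat \<Rightarrow> 'u \<Rightarrow> 'u \<Rightarrow> bool) \<Rightarrow>
    'v set \<Rightarrow> (nat \<times> 'v \<times> 'v) set \<Rightarrow> 'c set \<Rightarrow> bool"
  where "pattern_ramsey M I \<eta> R V E C \<longleftrightarrow>
    (\<forall>c. (\<forall>e. c e \<in> C) \<longrightarrow> (\<exists>f \<gamma>. uniform_copy M I \<eta> R V E c f \<gamma>))"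

lemma uniform_copy_embed:
  assumes "uniform_copy M I \<eta> R W D (\<lambda>(i, x, y). c (i, \<iota> x, \<iota> y)) f \<gamma>"
    and "inj_on \<iota> W" "\<iota> ` W \<subseteq> W'" "\<forall>i x y. (i, x, y) \<in> D \<longrightarrow> (i, \<iota> x, \<iota> y) \<in> D'"
  shows "uniform_copy M I \<eta> R W' D' c (\<iota> \<circ> f) \<gamma>"
proof -
  have f: "inj_on f {..<M}" "f ` {..<M} \<subseteq> W" using assms(1) by (auto simp: uniform_copy_def)
  have "inj_on (\<iota> \<circ> f) {..<M}" using f assms(2) by (blast intro: comp_inj_on inj_on_subset)
  moreover have "(\<iota> \<circ> f) ` {..<M} \<subseteq> W'" using f(2) assms(3) by auto
  ultimately show ?thesis using assms(1,4) by (simp add: uniform_copy_def)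
qed

text \<open>Ramsey's theorem for graphs, applied to pairs that are coloured by the vector of the
  colours of all their kinds.\<close>

lemma complete_pattern_ramsey:
  fixes C :: "'c set"
  assumes I: "finite I" and C: "finite C"
  shows "\<exists>N. pattern_ramsey M I \<eta> R {..<N::nat} {(i, x, y). i \<in> I \<and> x < y \<and> y < N} C"
proof -
  define P where "P = (I \<rightarrow>\<^sub>E C)"
  have "finite P" unfolding P_def using I C by (intro finite_PiE) auto
  then obtain h :: "(nat \<Rightarrow> 'c) \<Rightarrow> nat" and k where h: "inj_on h P" "h ` P = {i. i < k}"
    using finite_imp_inj_to_nat_seg by metis
  obtain N :: nat where N: "partn_lst {..<N} (replicate k M) 2"
    using ramsey_full[of "replicate k M" 2] by blast
  have "\<exists>f \<gamma>. uniform_copy M I \<eta> R {..<N} {(i, x, y). i \<in> I \<and> x < y \<and> y < N} c f \<gamma>"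
    if c: "\<forall>e. c e \<in> C" for c
  proof -
    define t where "t e = restrict (\<lambda>i. c (i, Min e, Max e)) I" for e :: "nat set"
    have tP: "t e \<in> P" for e using c by (auto simp: t_def P_def)
    then have "h (t e) < k" for e using h(2) by blast
    then have "(\<lambda>e. h (t e)) \<in> nsets {..<N} 2 \<rightarrow> {..<length (replicate k M)}" by auto
    from bspec[OF N[unfolded partn_lst_def] this]
    obtain l where "l < k" "monochromatic {..<N} M 2 (\<lambda>e. h (t e)) l" by auto
    then obtain K where K: "K \<subseteq> {..<N}" "finite K" "card K = M"
      and mono: "\<And>e. e \<in> nsets K 2 \<Longrightarrow> h (t e) = l"
      unfolding monochromatic_def by (auto simp: nsets_def[of "{..<N}"])
    define f where "f x = sorted_list_of_set K ! x" for x
    have fK: "f x \<in> K" if "x < M" for x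
      using that K by (metis f_def length_sorted_list_of_set nth_mem set_sorted_list_of_set)
    have less: "f x < f y" if "x < y" "y < M" for x y
      using that K strict_sorted_list_of_set[of K]
      by (metis f_def length_sorted_list_of_set sorted_wrt_nth_less)
    then have inj: "inj_on f {..<M}"
      by (intro inj_onI) (metis lessThan_iff less_irrefl linorder_neqE_nat)
    have const: "t {f x, f y} = t {f x', f y'}" if "x < y" "y < M" "x' < y'" "y' < M" for x y x' y'
    proof (rule inj_onD[OF h(1) _ tP tP])
      have "{f x, f y} \<in> nsets K 2" "{f x', f y'} \<in> nsets K 2"
        using that fK less[of x y] less[of x' y'] by auto
      then show "h (t {f x, f y}) = h (t {f x', f y'})" using mono by simp
    qed
    have val: "c (i, f x, f y) = t {f x, f y} i" if "i \<in> I" "x < y" "y < M" for i x y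
      using that less[OF that(2,3)] by (simp add: t_def)
    \<comment> \<open>The pair of 0 and 1 serves as reference. For \<open>M < 2\<close> it is no
      pair of positions, but then there is nothing to compare.\<close>
    have "c (i, f x, f y) = t {f 0, f 1} i" if "i \<in> I" "x < y" "y < M" for i x y
      using val[OF that] const[of x y 0 1] that by simp
    moreover have "f ` {..<M} \<subseteq> {..<N}" using fK K(1) by auto
    moreover have "f y < N" if "y < M" for y using fK[OF that] K(1) by auto
    ultimately have "uniform_copy M I \<eta> R {..<N} {(i, x, y). i \<in> I \<and> x < y \<and> y < N} c f (t {f 0, f 1})"
      using inj less unfolding uniform_copy_def by auto
    then show ?thesis by blast
  qed
  then show ?thesis unfolding pattern_ramsey_def by blast
qed

context homogeneous_template
begin

text \<open>The disjoint union of one private copy of the pattern for every placement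
  \<open>f\<close> of it in \<open>(V, E)\<close>, injective or not. A colouring that is constant
  over each edge of \<open>E\<close> descends to \<open>E\<close>, and the placement found there has
  a uniform private copy. Every private copy maps to the template by \<open>\<eta>\<close>.\<close>

lemma partite_start:
  assumes V: "finite V" and I: "finite I" and \<eta>: "\<eta> ` {..<M} \<subseteq> U"
    and ramsey: "pattern_ramsey M I \<eta> R V E C"
  shows "\<exists>(W :: nat set) D \<pi>. finite W \<and> finite D \<and> D \<subseteq> UNIV \<times> W \<times> W \<and> \<pi> ` W \<subseteq> V \<and>
    (\<forall>i x y. (i, x, y) \<in> D \<longrightarrow> (i, \<pi> x, \<pi> y) \<in> E) \<and> transversals_hom W D \<pi> U R \<and>
    (\<forall>c. (\<forall>e. c e \<in> C) \<longrightarrow>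
      (\<forall>(i, a, b)\<in>E. \<exists>\<gamma>. \<forall>x y. (i, x, y) \<in> D \<longrightarrow> \<pi> x = a \<longrightarrow> \<pi> y = b \<longrightarrow> c (i, x, y) = \<gamma>) \<longrightarrow>
      (\<exists>f \<gamma>. uniform_copy M I \<eta> R W D c f \<gamma>))"
proof -
  define B where "B = {(i, x, y). i \<in> I \<and> x < y \<and> y < M \<and> R i (\<eta> x) (\<eta> y)}"
  have finB: "finite B"
    by (rule finite_subset[of _ "I \<times> {..<M} \<times> {..<M}"]) (use I in \<open>auto simp: B_def\<close>)
  define F where "F = {f \<in> {..<M} \<rightarrow>\<^sub>E V. \<forall>(i, x, y)\<in>B. (i, f x, f y) \<in> E}"
  have finF: "finite F" unfolding F_def using V
    by (intro finite_subset[OF _ finite_PiE[of "{..<M}" "\<lambda>_. V"]]) auto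
  then obtain h :: "(nat \<Rightarrow> _) \<Rightarrow> nat" where h: "inj_on h F"
    using finite_imp_inj_to_nat_seg by metis
  define vx where "vx f x = prod_encode (h f, x)" for f x
  have vx_inject: "vx f x = vx g y \<longleftrightarrow> f = g \<and> x = y" if "f \<in> F" "g \<in> F" for f g x y
    using h that by (auto simp: vx_def dest: inj_onD)
  define fn where "fn v = inv_into F h (fst (prod_decode v))" for v
  define ix where "ix v = snd (prod_decode v)" for v
  have fn[simp]: "fn (vx f x) = f" if "f \<in> F" for f x
    using h that by (simp add: fn_def vx_def)
  have ix[simp]: "ix (vx f x) = x" for f x by (simp add: ix_def vx_def)
  define \<pi> where "\<pi> v = fn v (ix v)" for v
  define W where "W = (\<Union>f\<in>F. vx f ` {..<M})"
  define D where "D = (\<Union>f\<in>F. (\<lambda>(i, x, y). (i, vx f x, vx f y)) ` B)"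
  have DE: "\<exists>f\<in>F. \<exists>x0 y0. (i, x0, y0) \<in> B \<and> x = vx f x0 \<and> y = vx f y0" if "(i, x, y) \<in> D" for i x y
    using that by (auto simp: D_def)
  have fin: "finite W" "finite D" using finF finB by (auto simp: W_def D_def)
  have sub: "D \<subseteq> UNIV \<times> W \<times> W" by (fastforce simp: D_def W_def B_def)
  have img: "\<pi> ` W \<subseteq> V" by (auto simp: W_def \<pi>_def F_def PiE_iff)
  have hom: "\<forall>i x y. (i, x, y) \<in> D \<longrightarrow> (i, \<pi> x, \<pi> y) \<in> E"
  proof (intro allI impI)
    fix i x y assume "(i, x, y) \<in> D"
    from DE[OF this] obtain f x0 y0 where "f \<in> F" "(i, x0, y0) \<in> B" "x = vx f x0" "y = vx f y0"
      by blast
    then show "(i, \<pi> x, \<pi> y) \<in> E" by (auto simp: \<pi>_def F_def)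
  qed
  have "hom_on S D U R (\<lambda>v. \<eta> (ix v))" if "S \<subseteq> W" for S
    unfolding hom_on_def
  proof (intro conjI allI impI)
    have "\<eta> (ix v) \<in> U" if "v \<in> W" for v using that \<eta> by (auto simp: W_def)
    then show "(\<lambda>v. \<eta> (ix v)) ` S \<subseteq> U" using \<open>S \<subseteq> W\<close> by blast
    fix i x y assume "(i, x, y) \<in> D"
    then show "R i (\<eta> (ix x)) (\<eta> (ix y))" using DE by (fastforce simp: B_def)
  qed
  then have th: "transversals_hom W D \<pi> U R" unfolding transversals_hom_def by blast
  have "\<exists>f \<gamma>. uniform_copy M I \<eta> R W D c f \<gamma>"
    if c: "\<forall>e. c e \<in> C" and fib: "\<forall>(i, a, b)\<in>E. \<exists>\<gamma>. \<forall>x y. (i, x, y) \<in> D \<longrightarrow> \<pi> x = a \<longrightarrow> \<pi> y = b \<longrightarrow> c (i, x, y) = \<gamma>" for c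
  proof -
    \<comment> \<open>The common colour of the edges above \<open>(i, a, b)\<close>. Where no edge
      lies above, the choice is arbitrary but still gives a colour in \<open>C\<close>.\<close>
    define c' where "c' = (\<lambda>(i, a, b). c (SOME e. case e of (i', x, y) \<Rightarrow>
        (i', x, y) \<in> D \<and> i' = i \<and> \<pi> x = a \<and> \<pi> y = b))"
    have c'C: "\<forall>e. c' e \<in> C" by (simp add: c'_def c[rule_format] split: prod.split)
    have c': "c' (i, \<pi> x, \<pi> y) = c (i, x, y)" if d: "(i, x, y) \<in> D" for i x y
    proof -
      let ?Q = "\<lambda>e. case e of (i', x', y') \<Rightarrow> (i', x', y') \<in> D \<and> i' = i \<and> \<pi> x' = \<pi> x \<and> \<pi> y' = \<pi> y"
      have "?Q (SOME e. ?Q e)" by (rule someI[of ?Q "(i, x, y)"]) (use d in auto)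
      then obtain x' y' where e: "(SOME e. ?Q e) = (i, x', y')"
        and q: "(i, x', y') \<in> D" "\<pi> x' = \<pi> x" "\<pi> y' = \<pi> y"
        by (cases "SOME e. ?Q e") auto
      obtain \<gamma> where "\<forall>x' y'. (i, x', y') \<in> D \<longrightarrow> \<pi> x' = \<pi> x \<longrightarrow> \<pi> y' = \<pi> y \<longrightarrow> c (i, x', y') = \<gamma>"
        using bspec[OF fib, of "(i, \<pi> x, \<pi> y)"] hom d by auto
      then have "c (i, x', y') = c (i, x, y)" using q d by simp
      then show ?thesis using e by (simp add: c'_def)
    qed
    obtain g \<gamma> where g: "uniform_copy M I \<eta> R V E c' g \<gamma>"
      using ramsey c'C unfolding pattern_ramsey_def by blast
    define f where "f = restrict g {..<M}"
    have fF: "f \<in> F" using g by (auto simp: f_def F_def B_def uniform_copy_def)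
    have "uniform_copy M I \<eta> R W D c (vx f) \<gamma>"
      unfolding uniform_copy_def
    proof (intro conjI allI ballI impI)
      show "inj_on (vx f) {..<M}" using vx_inject[OF fF fF] by (auto intro: inj_onI)
      show "vx f ` {..<M} \<subseteq> W" using fF by (auto simp: W_def)
      fix x y i assume xy: "i \<in> I" "x < y" "y < M" "R i (\<eta> x) (\<eta> y)"
      then have "(i, x, y) \<in> B" by (simp add: B_def)
      then show D: "(i, vx f x, vx f y) \<in> D" using fF by (force simp: D_def)
      show "c (i, vx f x, vx f y) = \<gamma> i"
        using c'[OF D] g xy fF by (auto simp: uniform_copy_def \<pi>_def f_def)
    qed
    then show ?thesis by blast
  qed
  then have r: "\<forall>c. (\<forall>e. c e \<in> C) \<longrightarrow>
      (\<forall>(i, a, b)\<in>E. \<exists>\<gamma>. \<forall>x y. (i, x, y) \<in> D \<longrightarrow> \<pi> x = a \<longrightarrow> \<pi> y = b \<longrightarrow> c (i, x, y) = \<gamma>) \<longrightarrow>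
      (\<exists>f \<gamma>. uniform_copy M I \<eta> R W D c f \<gamma>)" by blast
  show ?thesis
    by (intro exI[of _ W] exI[of _ D] exI[of _ \<pi>] conjI fin sub img hom th r)
qed

text \<open>The edges of \<open>E\<close> are amalgamated one by one. Once those in \<open>P\<close>
  are done, uniform copies exist for all colourings that are constant over each remaining edge; at
  \<open>P = E\<close> this condition is void.\<close>

lemma partite_construction:
  fixes V :: "nat set" and C :: "'c set"
  assumes V: "finite V" and E: "finite E" and I: "finite I" and C: "finite C"
    and irrefl: "\<forall>i x y. (i, x, y) \<in> E \<longrightarrow> x \<noteq> y"
    and \<eta>: "\<eta> ` {..<M} \<subseteq> U" and ramsey: "pattern_ramsey M I \<eta> R V E C"
  shows "\<exists>(W :: nat set) D \<pi>. finite W \<and> finite D \<and> D \<subseteq> UNIV \<times> W \<times> W \<and> \<pi> ` W \<subseteq> V \<and>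
    (\<forall>i x y. (i, x, y) \<in> D \<longrightarrow> (i, \<pi> x, \<pi> y) \<in> E) \<and> transversals_hom W D \<pi> U R \<and>
    pattern_ramsey M I \<eta> R W D C"
proof -
  define fibre_const where "fibre_const T D \<pi> c \<longleftrightarrow> (\<forall>(i, a, b)\<in>T. \<exists>\<gamma>. \<forall>x y. (i, x, y) \<in> D \<longrightarrow>
      \<pi> x = a \<longrightarrow> \<pi> y = b \<longrightarrow> c (i, x, y) = \<gamma>)"
    for T D and \<pi> :: "nat \<Rightarrow> nat" and c :: "nat \<times> nat \<times> nat \<Rightarrow> 'c"
  have "\<exists>(W :: nat set) D \<pi>. finite W \<and> finite D \<and> D \<subseteq> UNIV \<times> W \<times> W \<and> \<pi> ` W \<subseteq> V \<and>
    (\<forall>i x y. (i, x, y) \<in> D \<longrightarrow> (i, \<pi> x, \<pi> y) \<in> E) \<and> transversals_hom W D \<pi> U R \<and>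
    (\<forall>c. (\<forall>e. c e \<in> C) \<longrightarrow> fibre_const (E - P) D \<pi> c \<longrightarrow> (\<exists>f \<gamma>. uniform_copy M I \<eta> R W D c f \<gamma>))"
    if "P \<subseteq> E" for P
    using finite_subset[OF that E] that
  proof (induction P rule: finite_induct)
    case empty
    show ?case
      using partite_start[OF V I \<eta> ramsey] unfolding fibre_const_def by simp
  next
    case (insert e P)
    obtain j a b where e: "e = (j, a, b)" by (cases e)
    then have "a \<noteq> b" using irrefl insert.prems by blast
    have "P \<subseteq> E" using insert.prems by blast
    from insert.IH[OF this] obtain W D \<pi> where finW: "finite W" and finD: "finite D"
      and DW: "D \<subseteq> UNIV \<times> W \<times> W" and img: "\<pi> ` W \<subseteq> V"
      and hom: "\<forall>i x y. (i, x, y) \<in> D \<longrightarrow> (i, \<pi> x, \<pi> y) \<in> E"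
      and th: "transversals_hom W D \<pi> U R"
      and r: "\<forall>c. (\<forall>e. c e \<in> C) \<longrightarrow> fibre_const (E - P) D \<pi> c \<longrightarrow> (\<exists>f \<gamma>. uniform_copy M I \<eta> R W D c f \<gamma>)"
      by blast
    from partite_amalgam[OF finW finD DW \<open>a \<noteq> b\<close> th C, of j]
    obtain W' :: "nat set" and D' \<pi>' where fin': "finite W'" "finite D'" and sub': "D' \<subseteq> UNIV \<times> W' \<times> W'"
      and img': "\<pi>' ` W' \<subseteq> \<pi> ` W"
      and proj: "\<forall>i x y. (i, x, y) \<in> D' \<longrightarrow> (\<exists>x0 y0. (i, x0, y0) \<in> D \<and> \<pi>' x = \<pi> x0 \<and> \<pi>' y = \<pi> y0)"
      and th': "transversals_hom W' D' \<pi>' U R"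
      and r': "\<forall>c. (\<forall>e. c e \<in> C) \<longrightarrow> (\<exists>\<iota>. inj_on \<iota> W \<and> \<iota> ` W \<subseteq> W' \<and>
        (\<forall>i x y. (i, x, y) \<in> D \<longrightarrow> (i, \<iota> x, \<iota> y) \<in> D') \<and> (\<forall>x\<in>W. \<pi>' (\<iota> x) = \<pi> x) \<and>
        (\<exists>\<gamma>. \<forall>x y. (j, x, y) \<in> D \<longrightarrow> \<pi> x = a \<longrightarrow> \<pi> y = b \<longrightarrow> c (j, \<iota> x, \<iota> y) = \<gamma>))"
      by (elim exE conjE) (rule that[rotated 5], assumption+)
    have hom': "\<forall>i x y. (i, x, y) \<in> D' \<longrightarrow> (i, \<pi>' x, \<pi>' y) \<in> E"
      using proj hom by metis
    have r'': "\<forall>c. (\<forall>e. c e \<in> C) \<longrightarrow> fibre_const (E - insert e P) D' \<pi>' c \<longrightarrow>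
        (\<exists>f \<gamma>. uniform_copy M I \<eta> R W' D' c f \<gamma>)"
    proof (intro allI impI)
      fix c :: "nat \<times> nat \<times> nat \<Rightarrow> _" assume c: "\<forall>e. c e \<in> C" and fc: "fibre_const (E - insert e P) D' \<pi>' c"
      from mp[OF spec[OF r'] c] obtain \<iota> \<gamma> where \<iota>: "inj_on \<iota> W" "\<iota> ` W \<subseteq> W'"
        "\<forall>i x y. (i, x, y) \<in> D \<longrightarrow> (i, \<iota> x, \<iota> y) \<in> D'" and \<pi>\<iota>: "\<forall>x\<in>W. \<pi>' (\<iota> x) = \<pi> x"
        and \<gamma>: "\<forall>x y. (j, x, y) \<in> D \<longrightarrow> \<pi> x = a \<longrightarrow> \<pi> y = b \<longrightarrow> c (j, \<iota> x, \<iota> y) = \<gamma>"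
        by (elim exE conjE) (rule that, assumption+)
      define c' where "c' = (\<lambda>(i, x, y). c (i, \<iota> x, \<iota> y))"
      \<comment> \<open>Over \<open>e\<close> constancy comes from the amalgam, over the other
        remaining edges from \<open>c\<close>, since the copy respects the projections.\<close>
      have "fibre_const (E - P) D \<pi> c'"
        unfolding fibre_const_def
      proof clarify
        fix i u v assume uv: "(i, u, v) \<in> E" "(i, u, v) \<notin> P"
        show "\<exists>\<gamma>. \<forall>x y. (i, x, y) \<in> D \<longrightarrow> \<pi> x = u \<longrightarrow> \<pi> y = v \<longrightarrow> c' (i, x, y) = \<gamma>"
        proof (cases "(i, u, v) = e")
          case True
          then show ?thesis using \<gamma> e by (auto simp: c'_def)
        next
          case False
          then have "(i, u, v) \<in> E - insert e P" using uv by blast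
          then obtain \<delta> where \<delta>: "\<forall>x y. (i, x, y) \<in> D' \<longrightarrow> \<pi>' x = u \<longrightarrow> \<pi>' y = v \<longrightarrow> c (i, x, y) = \<delta>"
            using bspec[OF fc[unfolded fibre_const_def], of "(i, u, v)"] by auto
          have "c' (i, x, y) = \<delta>" if d: "(i, x, y) \<in> D" "\<pi> x = u" "\<pi> y = v" for x y
          proof -
            have "x \<in> W" "y \<in> W" using d DW by auto
            then show ?thesis using \<delta> \<iota>(3) d \<pi>\<iota> by (simp add: c'_def)
          qed
          then show ?thesis by blast
        qed
      qed
      moreover have "\<forall>e. c' e \<in> C" by (simp add: c'_def c[rule_format] split: prod.split)
      ultimately obtain f \<gamma> where "uniform_copy M I \<eta> R W D c' f \<gamma>" using r by blast
      then show "\<exists>f \<gamma>. uniform_copy M I \<eta> R W' D' c f \<gamma>"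
        using uniform_copy_embed[OF _ \<iota>, of M I \<eta> R c f \<gamma>] unfolding c'_def by blast
    qed
    show ?case
      by (intro exI[of _ W'] exI[of _ D'] exI[of _ \<pi>'] conjI fin' sub' subset_trans[OF img' img] hom' th' r'')
  qed
  from this[of E] show ?thesis by (simp add: fibre_const_def pattern_ramsey_def)
qed

text \<open>Induction on \<open>m\<close>: in the partite construction over the previous structure, a set of \<open>m + 1\<close>
  vertices is a transversal or projects to at most \<open>m\<close> vertices.\<close>

theorem sparse_pattern_ramsey:
  fixes m :: nat and C :: "'c set"
  assumes I: "finite I" and C: "finite C" and \<eta>: "\<eta> ` {..<M} \<subseteq> U"
  shows "\<exists>(V :: nat set) E. finite V \<and> E \<subseteq> UNIV \<times> V \<times> V \<and> pattern_ramsey M I \<eta> R V E C \<and>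
    (\<forall>S\<subseteq>V. card S \<le> m \<longrightarrow> (\<exists>\<psi>. hom_on S E U R \<psi>))"
proof -
  have "\<exists>(V :: nat set) E. finite V \<and> finite E \<and> E \<subseteq> UNIV \<times> V \<times> V \<and>
    (\<forall>i x y. (i, x, y) \<in> E \<longrightarrow> x \<noteq> y) \<and> pattern_ramsey M I \<eta> R V E C \<and>
    (\<forall>S\<subseteq>V. card S \<le> m \<longrightarrow> (\<exists>\<psi>. hom_on S E U R \<psi>))"
  proof (induction m)
    case 0
    obtain N :: nat where N: "pattern_ramsey M I \<eta> R {..<N} {(i, x, y). i \<in> I \<and> x < y \<and> y < N} C"
      using complete_pattern_ramsey[OF I C, of M \<eta> R] by blast
    have "finite {(i, x, y). i \<in> I \<and> x < y \<and> y < N}"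
      by (rule finite_subset[of _ "I \<times> {..<N} \<times> {..<N}"]) (use I in auto)
    moreover have "\<exists>\<psi>. hom_on S {(i, x, y). i \<in> I \<and> x < y \<and> y < N} U R \<psi>"
      if "S \<subseteq> {..<N}" "card S \<le> 0" for S
      using that finite_subset[OF that(1)] by (auto simp: hom_on_def)
    ultimately show ?case
      using N by (intro exI[of _ "{..<N}"] exI[of _ "{(i, x, y). i \<in> I \<and> x < y \<and> y < N}"]) auto
  next
    case (Suc m)
    then obtain V :: "nat set" and E where V: "finite V" "finite E"
      and irrefl: "\<forall>i x y. (i, x, y) \<in> E \<longrightarrow> x \<noteq> y" and r: "pattern_ramsey M I \<eta> R V E C"
      and loc: "\<And>S. S \<subseteq> V \<Longrightarrow> card S \<le> m \<Longrightarrow> \<exists>\<psi>. hom_on S E U R \<psi>" by blast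
    from partite_construction[OF V I C irrefl \<eta> r]
    obtain W :: "nat set" and D \<pi> where W: "finite W" "finite D" "D \<subseteq> UNIV \<times> W \<times> W" and img: "\<pi> ` W \<subseteq> V"
      and hom: "\<forall>i x y. (i, x, y) \<in> D \<longrightarrow> (i, \<pi> x, \<pi> y) \<in> E"
      and th: "transversals_hom W D \<pi> U R" and r': "pattern_ramsey M I \<eta> R W D C"
      by blast
    have "\<exists>\<psi>. hom_on S D U R \<psi>" if S: "S \<subseteq> W" "card S \<le> Suc m" for S
    proof (cases "inj_on \<pi> S")
      case True
      then show ?thesis using th S(1) unfolding transversals_hom_def by blast
    next
      case False
      have "finite S" using S(1) W(1) finite_subset by blast
      then have "card (\<pi> ` S) < card S"
        using False card_image_le eq_card_imp_inj_on by (metis le_neq_implies_less)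
      then have "card (\<pi> ` S) \<le> m" using S(2) by simp
      moreover have "\<pi> ` S \<subseteq> V" using S(1) img by blast
      ultimately obtain \<psi> where "hom_on (\<pi> ` S) E U R \<psi>" using loc by blast
      then have "hom_on S D U R (\<psi> \<circ> \<pi>)" using hom unfolding hom_on_def by auto
      then show ?thesis by blast
    qed
    moreover have "\<forall>i x y. (i, x, y) \<in> D \<longrightarrow> x \<noteq> y" using hom irrefl by metis
    ultimately show ?case using W r' by blast
  qed
  then show ?thesis by blast
qed

end

section \<open>The template of words\<close>

text \<open>Padding with 0 from \<open>q\<close> on makes equality of functions the same as equality
  of words.\<close>

definition lex_words :: "nat \<Rightarrow> nat \<Rightarrow> (nat \<Rightarrow> nat) set" where
  "lex_words \<kappa> q = {u. (\<forall>j<q. u j < \<kappa>) \<and> (\<forall>j\<ge>q. u j = 0)}"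

text \<open>Kind \<open>q\<close> is equality of words. Its edges only serve the Ramsey argument: on a blow-up of the
  template they force all vertices to be joined to the apex vertices in the same way.\<close>

definition first_diff :: "nat \<Rightarrow> nat \<Rightarrow> (nat \<Rightarrow> nat) \<Rightarrow> (nat \<Rightarrow> nat) \<Rightarrow> bool" where
  "first_diff q i u v \<longleftrightarrow> i \<le> q \<and> (\<forall>j<i. u j = v j) \<and> (i < q \<longrightarrow> u i \<noteq> v i)"

lemma finite_lex_words: "finite (lex_words \<kappa> q)"
proof -
  have "lex_words \<kappa> q \<subseteq> {f. \<forall>x. (x \<in> {..<q} \<longrightarrow> f x \<in> {..<\<kappa>}) \<and> (x \<notin> {..<q} \<longrightarrow> f x = 0)}"
    by (auto simp: lex_words_def)
  then show ?thesis
    by (rule finite_subset) (intro finite_set_of_finite_funs finite_lessThan)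
qed

lemma first_diff_sym: "first_diff q i u v \<Longrightarrow> first_diff q i v u"
  by (auto simp: first_diff_def)

text \<open>The permutation of coordinate \<open>j\<close> may depend on the letter at
  \<open>i\<close>, but only behind \<open>i\<close>. Up to the first difference \<open>l\<close>
  two words meet the same permutations, because for \<open>i < j \<le> l\<close> their letters at
  \<open>i\<close> agree.\<close>

lemma first_diff_triangular:
  assumes inj: "\<And>j b. inj (\<tau> j b)" and tri: "\<And>j b b'. j \<le> i \<Longrightarrow> \<tau> j b = \<tau> j b'"
    and d: "first_diff q l w z"
  shows "first_diff q l (\<lambda>j. \<tau> j (w i) (w j)) (\<lambda>j. \<tau> j (z i) (z j))"
proof -
  have eq: "\<tau> j (w i) = \<tau> j (z i)" if "j \<le> l" for j
    using tri[of j "w i" "z i"] d that by (cases "j \<le> i") (auto simp: first_diff_def)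
  show ?thesis
    using d eq[of l] eq inj by (auto simp: first_diff_def inj_eq)
qed

text \<open>A triangular map does it. Before \<open>i\<close> each pair of words agrees and one
  transposition per coordinate is enough; at \<open>i\<close> both letters are moved; behind
  \<open>i\<close> the letter at \<open>i\<close> tells which of the two words to follow.\<close>

lemma lex_words_move:
  assumes "u \<in> lex_words \<kappa> q" "v \<in> lex_words \<kappa> q" "u' \<in> lex_words \<kappa> q" "v' \<in> lex_words \<kappa> q"
    and "first_diff q i u v" "first_diff q i u' v'"
  shows "\<exists>\<sigma>. \<sigma> u = u' \<and> \<sigma> v = v' \<and> \<sigma> ` lex_words \<kappa> q \<subseteq> lex_words \<kappa> q \<and>
    (\<forall>l. \<forall>x\<in>lex_words \<kappa> q. \<forall>y\<in>lex_words \<kappa> q. first_diff q l x y \<longrightarrow> first_diff q l (\<sigma> x) (\<sigma> y))"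
proof -
  let ?U = "lex_words \<kappa> q"
  define \<tau> where "\<tau> j b = (if j < i then transpose (u j) (u' j)
    else if j = i then transpose (transpose (u i) (u' i) (v i)) (v' i) \<circ> transpose (u i) (u' i)
    else if b = u i then transpose (u j) (u' j) else transpose (v j) (v' j))" for j b
  define \<sigma> where "\<sigma> w j = \<tau> j (w i) (w j)" for w j
  have lt: "a < \<kappa> \<Longrightarrow> b < \<kappa> \<Longrightarrow> c < \<kappa> \<Longrightarrow> transpose a b c < \<kappa>" for a b c :: nat
    by (auto simp: transpose_def)
  have inj: "inj (\<tau> j b)" for j b unfolding \<tau>_def by (auto intro!: inj_compose)
  have tri: "\<tau> j b = \<tau> j b'" if "j \<le> i" for j b b' using that by (auto simp: \<tau>_def)
  have zero: "u j = 0" "v j = 0" "u' j = 0" "v' j = 0" if "j \<ge> q" for j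
    using that assms by (auto simp: lex_words_def)
  have bound: "u j < \<kappa>" "v j < \<kappa>" "u' j < \<kappa>" "v' j < \<kappa>" if "j < q" for j
    using that assms by (auto simp: lex_words_def)
  have "\<sigma> w \<in> ?U" if w: "w \<in> ?U" for w
  proof -
    have "\<sigma> w j < \<kappa>" if "j < q" for j
      using bound[OF that] bound[of i] w that unfolding \<sigma>_def \<tau>_def
      by (auto simp: lex_words_def intro!: lt)
    moreover have "\<sigma> w j = 0" if "j \<ge> q" for j
      using zero[OF that] w that unfolding \<sigma>_def \<tau>_def by (auto simp: lex_words_def)
    ultimately show ?thesis by (simp add: lex_words_def)
  qed
  moreover have "first_diff q l (\<sigma> x) (\<sigma> y)" if "first_diff q l x y" for l x y
    using first_diff_triangular[of \<tau> i, OF inj tri that] unfolding \<sigma>_def by blast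
  moreover have iq: "i \<le> q" "\<And>j. j < i \<Longrightarrow> u j = v j" "\<And>j. j < i \<Longrightarrow> u' j = v' j"
    "i < q \<Longrightarrow> u i \<noteq> v i" "i < q \<Longrightarrow> u' i \<noteq> v' i"
    using assms by (auto simp: first_diff_def)
  moreover have "\<sigma> u = u'"
  proof
    fix j
    \<comment> \<open>The outer transposition must not disturb \<open>u' i\<close>. For
      \<open>i < q\<close> this holds because the letters at \<open>i\<close> are distinct in either
      pair; for \<open>i = q\<close> all letters are the padding 0.\<close>
    have "transpose (transpose (u i) (u' i) (v i)) (v' i) (u' i) = u' i"
      using iq(1,4,5) zero[of i] by (cases "i < q") (auto simp: transpose_def)
    then show "\<sigma> u j = u' j" by (auto simp: \<sigma>_def \<tau>_def)
  qed
  moreover have "\<sigma> v = v'"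
  proof
    fix j
    consider "j < i" | "j = i" | "j > i" "i < q" | "j > i" "i = q" using iq(1) by linarith
    then show "\<sigma> v j = v' j"
    proof cases
      case 1
      then show ?thesis using iq(2,3)[OF 1] by (simp add: \<sigma>_def \<tau>_def)
    next
      case 3
      then show ?thesis using iq(4) by (simp add: \<sigma>_def \<tau>_def)
    next
      case 4
      then show ?thesis using zero[of i] zero[of j] by (simp add: \<sigma>_def \<tau>_def)
    qed (simp add: \<sigma>_def \<tau>_def)
  qed
  ultimately show ?thesis by (intro exI[of _ \<sigma>]) auto
qed

text \<open>Vertex transitivity is edge transitivity for kind \<open>q\<close>, under which every
  word is related to itself.\<close>

lemma homogeneous_lex_words:
  assumes "\<kappa> > 0" shows "homogeneous_template (lex_words \<kappa> q) (first_diff q)"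
proof
  show "lex_words \<kappa> q \<noteq> {}" using assms by (auto simp: lex_words_def intro!: exI[of _ "\<lambda>_. 0"])
next
  fix u v assume "u \<in> lex_words \<kappa> q" "v \<in> lex_words \<kappa> q"
  then show "\<exists>\<sigma>. \<sigma> u = v \<and> \<sigma> ` lex_words \<kappa> q \<subseteq> lex_words \<kappa> q \<and>
    (\<forall>i. \<forall>x\<in>lex_words \<kappa> q. \<forall>y\<in>lex_words \<kappa> q. first_diff q i x y \<longrightarrow> first_diff q i (\<sigma> x) (\<sigma> y))"
    using lex_words_move[of u \<kappa> q u v v q] by (auto simp: first_diff_def)
qed (rule lex_words_move)

section \<open>The separating graph\<close>

definition mono_embedding ::
  "'v graph \<Rightarrow> 'w graph \<Rightarrow> ('w set \<Rightarrow> nat) \<Rightarrow> nat \<Rightarrow> ('v \<Rightarrow> 'w) \<Rightarrow> bool" where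
  "mono_embedding G F c i g \<longleftrightarrow> inj_on g (verts G) \<and> g ` verts G \<subseteq> verts F \<and>
     (\<forall>u v. {u, v} \<in> edges G \<longrightarrow> {g u, g v} \<in> edges F \<and> c {g u, g v} = i)"

lemma graph_edge_cases:
  assumes "is_graph G" "e \<in> edges G"
  obtains u v where "e = {u, v}" "u \<in> verts G" "v \<in> verts G" "u \<noteq> v"
  using assms unfolding is_graph_def by (meson nsets2_E subsetD)

lemma graph_edgeD:
  assumes "is_graph G" "{u, v} \<in> edges G"
  shows "u \<in> verts G" "v \<in> verts G" "u \<noteq> v"
proof -
  have "{u, v} \<in> [verts G]\<^bsup>2\<^esup>" using assms unfolding is_graph_def by blast
  then show "u \<in> verts G" "v \<in> verts G" "u \<noteq> v" unfolding doubleton_in_nsets_2 by simp_all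
qed

lemma mono_embedding_imp_copy:
  assumes G: "is_graph G" and g: "mono_embedding G F c i g"
  shows "\<exists>K. subgraph K F \<and> isomorphic G K \<and> (\<exists>i. \<forall>e\<in>edges K. c e = i)"
proof -
  define K where "K = (g ` verts G, (`) g ` edges G)"
  have inj: "inj_on g (verts G)" using g by (simp add: mono_embedding_def)
  have img: "\<exists>u v. e = {g u, g v} \<and> {u, v} \<in> edges G" if e: "e \<in> edges K" for e
  proof -
    obtain e0 where e0: "e0 \<in> edges G" "e = g ` e0" using e by (auto simp: K_def)
    obtain u v where "e0 = {u, v}" by (rule graph_edge_cases[OF G e0(1)])
    then show ?thesis using e0 by auto
  qed
  have "is_graph K"
    unfolding is_graph_def
  proof (intro conjI subsetI)
    show "finite (verts K)" "verts K \<noteq> {}" using G by (auto simp: K_def is_graph_def)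
    fix e assume "e \<in> edges K"
    then obtain u v where e: "e = {g u, g v}" "{u, v} \<in> edges G" using img by blast
    then show "e \<in> [verts K]\<^bsup>2\<^esup>"
      using graph_edgeD[OF G e(2)] inj by (auto simp: K_def dest: inj_onD)
  qed
  moreover have "verts K \<subseteq> verts F" using g by (auto simp: K_def mono_embedding_def)
  moreover have "edges K \<subseteq> edges F" using img g by (fastforce simp: mono_embedding_def)
  moreover have "isomorphic G K"
    unfolding isomorphic_def
  proof (intro exI[of _ g] conjI ballI)
    show "bij_betw g (verts G) (verts K)" using inj by (simp add: K_def bij_betw_def)
    fix u v assume uv: "u \<in> verts G" "v \<in> verts G"
    show "{u, v} \<in> edges G \<longleftrightarrow> {g u, g v} \<in> edges K"
    proof
      assume "{u, v} \<in> edges G"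
      then have "g ` {u, v} \<in> edges K" unfolding K_def snd_conv by (rule imageI)
      then show "{g u, g v} \<in> edges K" by simp
    next
      assume "{g u, g v} \<in> edges K"
      then obtain a b where ab: "{g u, g v} = {g a, g b}" "{a, b} \<in> edges G" using img by blast
      then have "{u, v} = {a, b}"
        using uv graph_edgeD[OF G ab(2)] inj by (auto simp: doubleton_eq_iff dest: inj_onD)
      then show "{u, v} \<in> edges G" using ab by simp
    qed
  qed
  moreover have "\<forall>e\<in>edges K. c e = i" using img g by (fastforce simp: mono_embedding_def)
  ultimately show ?thesis unfolding subgraph_def by blast
qed

lemma copy_imp_mono_embedding:
  assumes G: "is_graph G" and F: "subgraph K F" and iso: "isomorphic G K"
    and c: "\<forall>e\<in>edges K. c e = i"
  shows "\<exists>g. mono_embedding G F c i g"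
proof -
  obtain g where g: "bij_betw g (verts G) (verts K)"
    "\<forall>u\<in>verts G. \<forall>v\<in>verts G. {u, v} \<in> edges G \<longleftrightarrow> {g u, g v} \<in> edges K"
    using iso by (auto simp: isomorphic_def)
  have "mono_embedding G F c i g"
    unfolding mono_embedding_def
  proof (intro conjI allI impI)
    show "inj_on g (verts G)" "g ` verts G \<subseteq> verts F"
      using g(1) F by (auto simp: bij_betw_def subgraph_def)
    fix u v assume uv: "{u, v} \<in> edges G"
    then have "{g u, g v} \<in> edges K" using g(2) graph_edgeD[OF G uv] by blast
    then show "{g u, g v} \<in> edges F" "c {g u, g v} = i" using F c by (auto simp: subgraph_def)
  qed
  then show ?thesis by blast
qed

text \<open>An injective colouring; it ensures that the \<open>LEAST\<close> in
  \<open>chromatic_number\<close> is attained.\<close>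

lemma proper_colouring_exists: "is_graph G \<Longrightarrow> \<exists>k f. proper_colouring G k f"
proof -
  assume G: "is_graph G"
  then obtain h :: "_ \<Rightarrow> nat" where h: "inj_on h (verts G)"
    using finite_imp_inj_to_nat_seg unfolding is_graph_def by metis
  have fin: "finite (verts G)" using G by (simp add: is_graph_def)
  have "proper_colouring G (Suc (Max (h ` verts G))) (\<lambda>v. Suc (h v))"
    unfolding proper_colouring_def
  proof (intro conjI ballI impI)
    show "(\<lambda>v. Suc (h v)) ` verts G \<subseteq> {1..Suc (Max (h ` verts G))}" using fin by auto
    fix u v assume "u \<in> verts G" "v \<in> verts G" "{u, v} \<in> edges G"
    then show "Suc (h u) \<noteq> Suc (h v)" using graph_edgeD(3)[OF G] h by (auto dest: inj_onD)
  qed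
  then show ?thesis by blast
qed

lemma min_colour_class_attained:
  assumes "is_graph G"
  obtains f where "proper_colouring G (chromatic_number G) f"
    "card {v \<in> verts G. f v = 1} = min_colour_class G"
proof -
  obtain f where "proper_colouring G (chromatic_number G) f"
    using LeastI_ex[OF proper_colouring_exists[OF assms]] unfolding chromatic_number_def by blast
  then have "\<exists>n f. proper_colouring G (chromatic_number G) f \<and> n = card {v \<in> verts G. f v = 1}"
    by blast
  from LeastI_ex[OF this] that show ?thesis unfolding min_colour_class_def by metis
qed

lemma chromatic_number_le: "proper_colouring G k f \<Longrightarrow> chromatic_number G \<le> k"
  unfolding chromatic_number_def by (blast intro: Least_le)

lemma min_colour_class_le:
  "proper_colouring G (chromatic_number G) f \<Longrightarrow> min_colour_class G \<le> card {v \<in> verts G. f v = 1}"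
  unfolding min_colour_class_def by (blast intro: Least_le)

text \<open>Apex vertices are encoded by even numbers, the vertices of the sparse structure by odd ones;
  edges of kind \<open>q\<close> do not enter the graph.\<close>

definition apex_graph :: "nat \<Rightarrow> nat \<Rightarrow> nat set \<Rightarrow> (nat \<times> nat \<times> nat) set \<Rightarrow> nat graph" where
  "apex_graph q n V E = ((\<lambda>a. 2 * a) ` {..<n} \<union> (\<lambda>x. 2 * x + 1) ` V,
     {{2 * a, 2 * x + 1} | a x. a < n \<and> x \<in> V} \<union>
     {{2 * x + 1, 2 * y + 1} | x y. \<exists>i<q. (i, x, y) \<in> E})"

lemma apex_graph_is_graph:
  assumes "finite V" "V \<noteq> {}" "E \<subseteq> UNIV \<times> V \<times> V" "\<And>i x. i < q \<Longrightarrow> (i, x, x) \<notin> E"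
  shows "is_graph (apex_graph q n V E)"
  unfolding is_graph_def
proof (intro conjI subsetI)
  show "finite (verts (apex_graph q n V E))" "verts (apex_graph q n V E) \<noteq> {}"
    using assms by (auto simp: apex_graph_def)
  fix e assume "e \<in> edges (apex_graph q n V E)"
  then consider a x where "e = {2 * a, 2 * x + 1}" "a < n" "x \<in> V"
    | i x y where "e = {2 * x + 1, 2 * y + 1}" "i < q" "(i, x, y) \<in> E"
    by (auto simp: apex_graph_def)
  then show "e \<in> [verts (apex_graph q n V E)]\<^bsup>2\<^esup>"
  proof cases
    case 1
    have "2 * a \<noteq> 2 * x + 1" by presburger
    with 1 show ?thesis by (auto simp: apex_graph_def)
  next
    case 2
    then have "x \<in> V" "y \<in> V" "x \<noteq> y" using assms(3,4) by auto
    with 2 show ?thesis by (auto simp: apex_graph_def)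
  qed
qed

section \<open>Ramsey properties of the apex graph\<close>

lemma pigeonhole_classes:
  fixes q s :: nat
  assumes "\<And>a. a < q * s \<Longrightarrow> \<phi> a \<in> {1..q}" "q > 0"
  shows "\<exists>i\<in>{1..q}. s \<le> card {a. a < q * s \<and> \<phi> a = i}"
proof (rule ccontr)
  assume "\<not> ?thesis"
  then have less: "card {a. a < q * s \<and> \<phi> a = i} < s" if "i \<in> {1..q}" for i
    using that by (meson not_le)
  have "{..<q * s} = (\<Union>i\<in>{1..q}. {a. a < q * s \<and> \<phi> a = i})" using assms(1) by auto
  then have "q * s \<le> (\<Sum>i\<in>{1..q}. card {a. a < q * s \<and> \<phi> a = i})"
    by (metis card_UN_le card_lessThan finite_atLeastAtMost)
  also have "\<dots> < (\<Sum>i\<in>{1..q}. s)" using less assms(2) by (intro sum_strict_mono) auto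
  finally show False by simp
qed

lemma residue_class_card_le:
  fixes q s i :: nat
  shows "card {a. a < q * s \<and> a mod q = i} \<le> s"
proof -
  have "inj_on (\<lambda>a. a div q) {a. a < q * s \<and> a mod q = i}"
  proof (rule inj_onI)
    fix a b assume "a \<in> {a. a < q * s \<and> a mod q = i}" "b \<in> {a. a < q * s \<and> a mod q = i}"
      "a div q = b div q"
    then have "a div q * q + a mod q = b div q * q + b mod q" by simp
    then show "a = b" by (simp only: div_mult_mod_eq)
  qed
  moreover have "(\<lambda>a. a div q) ` {a. a < q * s \<and> a mod q = i} \<subseteq> {..<s}"
    by (auto simp: less_mult_imp_div_less mult.commute)
  ultimately have "card {a. a < q * s \<and> a mod q = i} \<le> card {..<s}"
    by (rule card_inj_on_le) simp
  then show ?thesis by simp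
qed

text \<open>A monochromatic copy of \<open>H\<close> would inherit a colouring with
  \<open>Suc \<kappa>\<close> colours: one coordinate of the words takes care of the part in
  \<open>V\<close>, and colour 1 goes to the at most \<open>s\<close> apex vertices whose edges have
  the colour of the copy.\<close>

lemma apex_graph_avoids:
  assumes H: "is_graph H" and q: "q > 0" and \<kappa>: "\<kappa> > 0"
    and loc: "\<And>S. S \<subseteq> V \<Longrightarrow> card S \<le> card (verts H) \<Longrightarrow>
        \<exists>\<psi>. hom_on S E (lex_words \<kappa> q) (first_diff q) \<psi>"
    and no: "\<And>f. proper_colouring H (Suc \<kappa>) f \<Longrightarrow> s < card {v \<in> verts H. f v = 1}"
  shows "\<not> q_ramsey (apex_graph q (q * s) V E) H q"
proof
  let ?F = "apex_graph q (q * s) V E"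
  assume "q_ramsey ?F H q"
  define sp where "sp e i \<longleftrightarrow> i < q \<and> (\<exists>x y. (i, x, y) \<in> E \<and> e = {2 * x + 1, 2 * y + 1})" for e i
  define ap where "ap e a \<longleftrightarrow> (\<exists>x. e = {2 * a, 2 * x + 1})" for e :: "nat set" and a
  \<comment> \<open>Edges at an apex vertex \<open>a\<close> are coloured by \<open>a mod q\<close>,
    edges inside \<open>V\<close> by kind. A pair may carry several kinds, hence the
    \<open>LEAST\<close>; the \<open>Suc\<close> shifts to colours from 1 to
    \<open>q\<close>.\<close>
  define c where "c e = (if \<exists>a. ap e a then Suc ((SOME a. ap e a) mod q) else Suc (LEAST i. sp e i))" for e
  have par: "2 * a \<noteq> 2 * x + 1" "2 * x + 1 \<noteq> 2 * a" for a x :: nat by presburger+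
  have ap_eq: "ap {2 * a, 2 * x + 1} a' \<longleftrightarrow> a' = a" for a x a'
    using par unfolding ap_def by (auto simp: doubleton_eq_iff)
  have no_ap: "\<not> ap {2 * x + 1, 2 * y + 1} a" for x y a
    using par unfolding ap_def by (auto simp: doubleton_eq_iff)
  have c_ap: "c {2 * a, 2 * x + 1} = Suc (a mod q)" for a x
    unfolding c_def ap_eq by simp
  have c_sp: "sp e i" if "sp e j" "c e = Suc i" for e i j
  proof -
    have "\<not> (\<exists>a. ap e a)" using that(1) no_ap unfolding sp_def by blast
    then have "i = (LEAST i. sp e i)" using that(2) by (simp add: c_def)
    then show ?thesis using LeastI[of "sp e", OF that(1)] by simp
  qed
  have edge: "(\<exists>a x. e = {2 * a, 2 * x + 1} \<and> a < q * s \<and> x \<in> V) \<or> (\<exists>i. sp e i)" if "e \<in> edges ?F" for e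
    using that unfolding apex_graph_def snd_conv Un_iff mem_Collect_eq sp_def by blast
  have range: "c e \<in> {1..q}" if "e \<in> edges ?F" for e
    using edge[OF that]
  proof
    assume "\<exists>a x. e = {2 * a, 2 * x + 1} \<and> a < q * s \<and> x \<in> V"
    then show ?thesis using c_ap q by (auto simp: Suc_le_eq)
  next
    assume "\<exists>i. sp e i"
    then obtain j where j: "sp e j" by blast
    obtain i where i: "c e = Suc i" unfolding c_def by metis
    from c_sp[OF j i] show ?thesis using i by (simp add: sp_def)
  qed
  then have "c ` edges ?F \<subseteq> {1..q}" by blast
  with \<open>q_ramsey ?F H q\<close> obtain K i0 where K: "subgraph K ?F" "isomorphic H K" "\<forall>e\<in>edges K. c e = i0"
    unfolding q_ramsey_def by blast
  \<comment> \<open>For a copy without edges \<open>i0\<close> may lie outside the palette, but then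
    every \<open>i\<close> will do.\<close>
  have "\<exists>i<q. \<forall>e\<in>edges K. c e = Suc i"
  proof (cases "edges K = {}")
    case True
    then show ?thesis using q by auto
  next
    case False
    then obtain e where "e \<in> edges K" by blast
    moreover from this have "e \<in> edges ?F" using K(1) unfolding subgraph_def by blast
    ultimately have "i0 \<in> {1..q}" using range K(3) by auto
    then show ?thesis using K(3) by (intro exI[of _ "i0 - 1"]) auto
  qed
  then obtain i where i: "i < q" "\<forall>e\<in>edges K. c e = Suc i" by blast
  obtain g where g: "mono_embedding H ?F c (Suc i) g"
    using copy_imp_mono_embedding[OF H K(1,2) i(2)] by blast
  have fin: "finite (verts H)" using H by (simp add: is_graph_def)
  define S where "S = {x \<in> V. \<exists>v\<in>verts H. g v = 2 * x + 1}"
  have "S \<subseteq> (\<lambda>v. g v div 2) ` verts H" unfolding S_def by force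
  then have "card S \<le> card (verts H)" using fin by (rule surj_card_le[rotated])
  then obtain \<psi> where \<psi>: "hom_on S E (lex_words \<kappa> q) (first_diff q) \<psi>"
    using loc[of S] by (auto simp: S_def)
  \<comment> \<open>Apex vertices of residue \<open>i\<close> get colour 1. The other apex vertices
    have no edge in the copy and may take colour 2. Vertices in \<open>V\<close> are coloured by
    letter \<open>i\<close> of their word, moved up by 2.\<close>
  define f where "f v = (if even (g v) then if g v div 2 mod q = i then 1 else 2
    else Suc (Suc (\<psi> (g v div 2) i)))" for v
  have vert: "(\<exists>a<q * s. g v = 2 * a) \<or> (\<exists>x\<in>S. g v = 2 * x + 1)" if "v \<in> verts H" for v
  proof -
    have "g v \<in> verts ?F" using g that by (auto simp: mono_embedding_def)
    then show ?thesis using that by (auto simp: apex_graph_def S_def)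
  qed
  have f_even: "f v = (if a mod q = i then 1 else 2)" if "g v = 2 * a" for v a
    using that by (simp add: f_def)
  have f_odd: "f v = Suc (Suc (\<psi> x i))" if "g v = 2 * x + 1" for v x
    using that by (simp add: f_def)
  have edge_neq: "f u \<noteq> f v" if uv: "{u, v} \<in> edges H" for u v
  proof -
    have e: "{g u, g v} \<in> edges ?F" "c {g u, g v} = Suc i" using g uv by (auto simp: mono_embedding_def)
    from edge[OF e(1)] show ?thesis
    proof (elim disjE exE conjE)
      fix a x assume ax: "{g u, g v} = {2 * a, 2 * x + 1}"
      then have "a mod q = i" using e(2) c_ap by simp
      moreover have "g u = 2 * a \<and> g v = 2 * x + 1 \<or> g v = 2 * a \<and> g u = 2 * x + 1"
        using ax by (auto simp: doubleton_eq_iff)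
      ultimately show ?thesis using f_even f_odd by auto
    next
      fix j assume "sp {g u, g v} j"
      from c_sp[OF this e(2)] obtain x y where xy: "(i, x, y) \<in> E" "{g u, g v} = {2 * x + 1, 2 * y + 1}"
        by (auto simp: sp_def)
      then have cases: "g u = 2 * x + 1 \<and> g v = 2 * y + 1 \<or> g v = 2 * x + 1 \<and> g u = 2 * y + 1"
        by (auto simp: doubleton_eq_iff)
      then have "x \<in> S" "y \<in> S"
        using vert[OF graph_edgeD(1)[OF H uv]] vert[OF graph_edgeD(2)[OF H uv]] par by auto
      then have "\<psi> x i \<noteq> \<psi> y i" using \<psi> xy(1) i(1) by (auto simp: hom_on_def first_diff_def)
      then show ?thesis using cases f_odd by auto
    qed
  qed
  have "proper_colouring H (Suc \<kappa>) f"
    unfolding proper_colouring_def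
  proof (intro conjI ballI impI)
    have "f v \<in> {1..Suc \<kappa>}" if v: "v \<in> verts H" for v
      using vert[OF v]
    proof
      assume "\<exists>a<q * s. g v = 2 * a"
      then show ?thesis using f_even \<kappa> by auto
    next
      assume "\<exists>x\<in>S. g v = 2 * x + 1"
      then obtain x where x: "x \<in> S" "g v = 2 * x + 1" by blast
      then have "\<psi> x i < \<kappa>" using \<psi> i(1) by (auto simp: hom_on_def lex_words_def)
      then show ?thesis using f_odd[OF x(2)] by simp
    qed
    then show "f ` verts H \<subseteq> {1..Suc \<kappa>}" by blast
  qed (rule edge_neq)
  then have "s < card {v \<in> verts H. f v = 1}" by (rule no)
  also have "\<dots> \<le> card {a. a < q * s \<and> a mod q = i}"
  proof (rule card_inj_on_le)
    have even: "\<exists>a. g v = 2 * a \<and> a < q * s \<and> a mod q = i" if "v \<in> verts H" "f v = 1" for v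
      using vert[OF that(1)] that(2) f_even f_odd by (auto split: if_splits)
    have inj: "inj_on g (verts H)" using g by (simp add: mono_embedding_def)
    show "inj_on (\<lambda>v. g v div 2) {v \<in> verts H. f v = 1}"
    proof (rule inj_onI)
      fix u v assume uv: "u \<in> {v \<in> verts H. f v = 1}" "v \<in> {v \<in> verts H. f v = 1}" "g u div 2 = g v div 2"
      then obtain a b where "g u = 2 * a" "g v = 2 * b" using even[of u] even[of v] by blast
      then have "g u = g v" using uv(3) by simp
      then show "u = v" using inj_onD[OF inj] uv(1,2) by blast
    qed
    show "(\<lambda>v. g v div 2) ` {v \<in> verts H. f v = 1} \<subseteq> {a. a < q * s \<and> a mod q = i}"
    proof clarify
      fix v assume "v \<in> verts H" "f v = 1"
      then obtain a where "g v = 2 * a" "a < q * s" "a mod q = i" using even by blast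
      then show "g v div 2 < q * s \<and> g v div 2 mod q = i" by simp
    qed
    show "finite {a. a < q * s \<and> a mod q = i}" by simp
  qed
  also have "\<dots> \<le> s" by (rule residue_class_card_le)
  finally show False by simp
qed

text \<open>Position \<open>p\<close> lies in class \<open>p mod L\<close>. Each vertex of
  \<open>A\<close> gets a layer \<open>h v\<close> of its own, and there are \<open>t\<close>
  layers.\<close>

lemma blow_up_embedding:
  assumes fin: "finite A" and \<rho>: "\<rho> ` A \<subseteq> en ` {..<L}" and A: "card A \<le> t"
  obtains X :: "'a \<Rightarrow> nat" where "inj_on X A" "\<And>v. v \<in> A \<Longrightarrow> X v < L * t"
    "\<And>v. v \<in> A \<Longrightarrow> en (X v mod L) = \<rho> v"
proof -
  obtain h where h: "bij_betw h A {0..<card A}" using ex_bij_betw_finite_nat[OF fin] by blast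
  have "\<forall>v\<in>A. \<exists>p<L. en p = \<rho> v" using \<rho> by force
  then obtain p where p: "\<And>v. v \<in> A \<Longrightarrow> p v < L \<and> en (p v) = \<rho> v" by metis
  define X where "X v = h v * L + p v" for v
  have mod: "X v mod L = p v" and div: "X v div L = h v" if "v \<in> A" for v
    using p[OF that] by (simp_all add: X_def)
  have "inj_on X A"
    using div bij_betw_imp_inj_on[OF h] by (intro inj_onI) (metis inj_onD)
  moreover have "X v < L * t" if "v \<in> A" for v
  proof -
    have "h v < t" using bij_betwE[OF h] that A by fastforce
    have "X v < h v * L + L" using p[OF that] by (simp add: X_def)
    also have "\<dots> = Suc (h v) * L" by simp
    also have "\<dots> \<le> t * L" using \<open>h v < t\<close> by (intro mult_le_mono1) simp
    finally show ?thesis by (simp add: mult.commute)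
  qed
  ultimately show thesis using that mod p by metis
qed

text \<open>The palette records, besides the colour of a pair, how both ends are joined to the apex
  vertices, so in the uniform copy all vertices are joined alike. If the popular apex colour
  \<open>b\<close> is the colour of a kind, or \<open>\<kappa> = 1\<close>, class 1 of
  \<open>G\<close> goes to apex vertices; otherwise two kinds share a colour and \<open>G\<close>
  fits inside \<open>V\<close>.\<close>

lemma apex_graph_forces:
  assumes G: "is_graph G" and q: "q > 0" and \<kappa>: "\<kappa> > 0"
    and col: "proper_colouring G (Suc \<kappa>) col" and s: "card {v \<in> verts G. col v = 1} = s"
    and t: "card (verts G) \<le> t" "3 \<le> t"
    and en: "en ` {..<L} = lex_words \<kappa> q"
    and P: "P = {..<q * s} \<rightarrow>\<^sub>E {1..q}"
    and ramsey: "pattern_ramsey (L * t) {..q} (\<lambda>x. en (x mod L)) (first_diff q) V E ({1..q} \<times> P \<times> P)"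
  shows "q_ramsey (apex_graph q (q * s) V E) G q"
  unfolding q_ramsey_def
proof (intro allI impI)
  let ?F = "apex_graph q (q * s) V E"
  let ?\<eta> = "\<lambda>x. en (x mod L)"
  fix c :: "nat set \<Rightarrow> nat" assume c: "c ` edges ?F \<subseteq> {1..q}"
  have c_range: "c e \<in> {1..q}" if "e \<in> edges ?F" for e using c that by blast
  have cA: "{2 * a, 2 * x + 1} \<in> edges ?F" if "a < q * s" "x \<in> V" for a x
    using that by (auto simp: apex_graph_def)
  have cE: "{2 * x + 1, 2 * y + 1} \<in> edges ?F" if "(i, x, y) \<in> E" "i < q" for i x y
    using that by (auto simp: apex_graph_def)
  \<comment> \<open>\<open>\<phi> x\<close> lists the colours between \<open>x\<close> and the apex
    vertices. The default 1, here and in \<open>cc\<close> for triples that are no edges of the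
    graph (such as those of kind \<open>q\<close>), keeps all values within the palette.\<close>
  define \<phi> where "\<phi> x = restrict (\<lambda>a. if x \<in> V then c {2 * a, 2 * x + 1} else 1) {..<q * s}" for x
  define cc where "cc = (\<lambda>(i, x, y). (if (i, x, y) \<in> E \<and> i < q then c {2 * x + 1, 2 * y + 1} else 1, \<phi> x, \<phi> y))"
  have \<phi>P: "\<phi> x \<in> P" for x
  proof -
    have "(if x \<in> V then c {2 * a, 2 * x + 1} else 1) \<in> {1..q}" if "a < q * s" for a
      using c_range[OF cA[OF that]] q by (cases "x \<in> V") auto
    then show ?thesis by (simp add: \<phi>_def P)
  qed
  have "cc (i, x, y) \<in> {1..q} \<times> P \<times> P" for i x y
    using \<phi>P c_range[OF cE[of i x y]] q by (simp add: cc_def)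
  then have "\<forall>e. cc e \<in> {1..q} \<times> P \<times> P" by (metis prod_cases3)
  then obtain f \<gamma> where "uniform_copy (L * t) {..q} ?\<eta> (first_diff q) V E cc f \<gamma>"
    using ramsey unfolding pattern_ramsey_def by blast
  then have inj_f: "inj_on f {..<L * t}" and fV: "\<And>x. x < L * t \<Longrightarrow> f x \<in> V"
    and copy: "\<And>i x y. i \<le> q \<Longrightarrow> x < y \<Longrightarrow> y < L * t \<Longrightarrow> first_diff q i (?\<eta> x) (?\<eta> y) \<Longrightarrow>
      (i, f x, f y) \<in> E \<and> cc (i, f x, f y) = \<gamma> i"
    unfolding uniform_copy_def by (auto simp: atMost_iff)
  have "(\<lambda>_. 0) \<in> lex_words \<kappa> q" using \<kappa> by (auto simp: lex_words_def)
  then have L: "L > 0" using en by (cases L) auto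
  \<comment> \<open>Positions congruent modulo \<open>L\<close> form an edge of kind
    \<open>q\<close>, whose uniform value contains the types of both ends.\<close>
  have types: "\<phi> (f x) = fst (snd (\<gamma> q)) \<and> \<phi> (f (x + L * l)) = snd (snd (\<gamma> q))"
    if "x + L * l < L * t" "l > 0" for x l
  proof -
    have "cc (q, f x, f (x + L * l)) = \<gamma> q"
      using copy[of q x "x + L * l"] that L by (auto simp: first_diff_def)
    then have "\<gamma> q = (1, \<phi> (f x), \<phi> (f (x + L * l)))" by (simp add: cc_def)
    then show ?thesis by simp
  qed
  \<comment> \<open>Position \<open>L\<close> is the upper end of a kind \<open>q\<close> pair with
    0 and the lower end of one with \<open>2 * L\<close>; this takes three layers.\<close>
  have same: "fst (snd (\<gamma> q)) = snd (snd (\<gamma> q))"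
  proof -
    have "0 + L * 1 < L * t" "L + L * 1 < L * t" using L t(2) by (auto simp flip: mult_2_right)
    with types[of 0 1] types[of L 1] show ?thesis by simp
  qed
  define \<Phi> where "\<Phi> = fst (snd (\<gamma> q))"
  have \<phi>f: "\<phi> (f x) = \<Phi>" if x: "x < L * t" for x
  proof (cases "x + L < L * t")
    case True
    then show ?thesis using types[of x 1] by (simp add: \<Phi>_def)
  next
    case False
    have "L * 3 \<le> L * t" using t(2) by simp
    then have "x \<ge> L" using False L by linarith
    then show ?thesis using types[of "x - L" 1] x same by (simp add: \<Phi>_def)
  qed
  have apex: "c {2 * a, 2 * f x + 1} = \<Phi> a" if "x < L * t" "a < q * s" for a x
    using \<phi>f[OF that(1)] that(2) fV[OF that(1)] by (auto simp: \<phi>_def)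
  have "\<Phi> a \<in> {1..q}" if "a < q * s" for a
    using apex[of 0 a] c_range[OF cA[OF that fV[of 0]]] L t(2) that by simp
  from pigeonhole_classes[of q s \<Phi>, OF this q]
  obtain b where b: "b \<in> {1..q}" "s \<le> card {a. a < q * s \<and> \<Phi> a = b}" by blast
  have kind: "{2 * f x + 1, 2 * f y + 1} \<in> edges ?F \<and> c {2 * f x + 1, 2 * f y + 1} = fst (\<gamma> i)"
    if "i < q" "x < L * t" "y < L * t" "first_diff q i (?\<eta> x) (?\<eta> y)" for i x y
  proof -
    have *: "{2 * f x + 1, 2 * f y + 1} \<in> edges ?F \<and> c {2 * f x + 1, 2 * f y + 1} = fst (\<gamma> i)"
      if "x < y" "y < L * t" "first_diff q i (?\<eta> x) (?\<eta> y)" for x y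
    proof -
      have "(i, f x, f y) \<in> E" "cc (i, f x, f y) = \<gamma> i"
        using copy[of i x y] that \<open>i < q\<close> by auto
      then have "\<gamma> i = (c {2 * f x + 1, 2 * f y + 1}, \<phi> (f x), \<phi> (f y))"
        using \<open>i < q\<close> by (simp add: cc_def)
      then show ?thesis using cE[OF \<open>(i, f x, f y) \<in> E\<close> \<open>i < q\<close>] by simp
    qed
    have "x \<noteq> y" using that by (auto simp: first_diff_def)
    then consider "x < y" | "y < x" by linarith
    then show ?thesis
      using *[of x y] *[of y x] that first_diff_sym by cases (auto simp: insert_commute)
  qed
  have fin: "finite (verts G)" using G by (simp add: is_graph_def)
  have colr: "col v \<in> {1..Suc \<kappa>}" if "v \<in> verts G" for v
    using col that by (auto simp: proper_colouring_def)
  have coln: "col u \<noteq> col v" if "{u, v} \<in> edges G" for u v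
    using col graph_edgeD[OF G that] that by (auto simp: proper_colouring_def)
  have "\<exists>i g. mono_embedding G ?F c i g"
  proof (cases "\<kappa> = 1 \<or> (\<exists>j<q. fst (\<gamma> j) = b)")
    case True
    then obtain j where j: "j < q" "\<kappa> = 1 \<or> fst (\<gamma> j) = b" using q by blast
    define A where "A = {v \<in> verts G. col v \<noteq> 1}"
    \<comment> \<open>Colours from 2 to \<open>Suc \<kappa>\<close> become letters at coordinate
      \<open>j\<close>, so different classes are joined by kind \<open>j\<close>. For
      \<open>\<kappa> = 1\<close> only one class is left and there is no edge inside
      \<open>A\<close>.\<close>
    define \<rho> where "\<rho> v = (\<lambda>l. if l = j then col v - 2 else 0)" for v
    have "\<rho> ` A \<subseteq> lex_words \<kappa> q"
    proof clarify
      fix v assume "v \<in> A"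
      then have "col v - 2 < \<kappa>" using colr[of v] \<kappa> by (auto simp: A_def)
      then show "\<rho> v \<in> lex_words \<kappa> q" using j(1) \<kappa> by (auto simp: \<rho>_def lex_words_def)
    qed
    moreover have "finite A" using fin by (simp add: A_def)
    moreover have "card A \<le> t"
      using card_mono[OF fin, of A] t(1) by (auto simp: A_def)
    ultimately obtain X where X: "inj_on X A" "\<And>v. v \<in> A \<Longrightarrow> X v < L * t" "\<And>v. v \<in> A \<Longrightarrow> ?\<eta> (X v) = \<rho> v"
      using blow_up_embedding[of A \<rho> en L t] en by metis
    define B where "B = {v \<in> verts G. col v = 1}"
    have "finite B" using fin by (simp add: B_def)
    moreover have "card B \<le> card {a. a < q * s \<and> \<Phi> a = b}" using s b by (simp add: B_def)
    ultimately obtain Y where Y: "inj_on Y B" "Y ` B \<subseteq> {a. a < q * s \<and> \<Phi> a = b}"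
      using inj_on_iff_card_le[of B "{a. a < q * s \<and> \<Phi> a = b}"] by auto
    define g where "g v = (if col v = 1 then 2 * Y v else 2 * f (X v) + 1)" for v
    have par: "2 * a \<noteq> 2 * x + 1" "2 * x + 1 \<noteq> 2 * a" for a x :: nat by presburger+
    have "inj_on g (verts G)"
    proof (rule inj_onI)
      fix u v assume uv: "u \<in> verts G" "v \<in> verts G" "g u = g v"
      then consider "u \<in> B" "v \<in> B" "Y u = Y v" | "u \<in> A" "v \<in> A" "f (X u) = f (X v)"
        using par by (auto simp: g_def A_def B_def split: if_splits)
      then show "u = v"
      proof cases
        case 1
        then show ?thesis using Y(1) by (auto dest: inj_onD)
      next
        case 2
        then have "X u = X v" using X(2) inj_f by (auto dest: inj_onD)
        then show ?thesis using X(1) 2 by (auto dest: inj_onD)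
      qed
    qed
    moreover have "g ` verts G \<subseteq> verts ?F"
    proof clarify
      fix v assume v: "v \<in> verts G"
      show "g v \<in> verts ?F"
      proof (cases "col v = 1")
        case True
        then have "Y v < q * s" using v Y(2) by (auto simp: B_def)
        then show ?thesis using True by (auto simp: g_def apex_graph_def)
      next
        case False
        then have "f (X v) \<in> V" using v X(2) fV by (auto simp: A_def)
        then show ?thesis using False by (auto simp: g_def apex_graph_def)
      qed
    qed
    moreover have "{g u, g v} \<in> edges ?F \<and> c {g u, g v} = b" if uv: "{u, v} \<in> edges G" for u v
    proof -
      have mixed: "{g u, g v} \<in> edges ?F \<and> c {g u, g v} = b" if "u \<in> B" "v \<in> A" for u v
      proof -
        have Yu: "Y u < q * s" "\<Phi> (Y u) = b" using Y(2) that(1) by auto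
        have Xv: "X v < L * t" "f (X v) \<in> V" using X(2) fV that(2) by auto
        have "g u = 2 * Y u" "g v = 2 * f (X v) + 1" using that by (auto simp: g_def A_def B_def)
        then show ?thesis using apex[OF Xv(1) Yu(1)] cA[OF Yu(1) Xv(2)] Yu(2) by simp
      qed
      have mem: "u \<in> verts G" "v \<in> verts G" using graph_edgeD[OF G uv] by auto
      consider "u \<in> B" "v \<in> A" | "v \<in> B" "u \<in> A" | "u \<in> A" "v \<in> A"
        using mem coln[OF uv] by (auto simp: A_def B_def)
      then show ?thesis
      proof cases
        case 1
        then show ?thesis by (rule mixed)
      next
        case 2
        show ?thesis using mixed[OF 2] by (simp add: insert_commute)
      next
        case 3
        have "2 \<le> col u" "2 \<le> col v" "col u \<le> Suc \<kappa>" "col v \<le> Suc \<kappa>"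
          using 3 colr[of u] colr[of v] by (auto simp: A_def)
        then have d: "col u - 2 \<noteq> col v - 2" "\<kappa> \<noteq> 1" using coln[OF uv] by auto
        then have "first_diff q j (?\<eta> (X u)) (?\<eta> (X v))"
          unfolding X(3)[OF 3(1)] X(3)[OF 3(2)] using j(1) by (auto simp: \<rho>_def first_diff_def)
        from kind[OF j(1) X(2)[OF 3(1)] X(2)[OF 3(2)] this] j(2) d(2)
        show ?thesis using 3 by (simp add: g_def A_def)
      qed
    qed
    ultimately have "mono_embedding G ?F c b g" unfolding mono_embedding_def by blast
    then show ?thesis by blast
  next
    case False
    then have \<kappa>2: "\<kappa> \<ge> 2" and nb: "\<And>j. j < q \<Longrightarrow> fst (\<gamma> j) \<noteq> b" using \<kappa> by auto
    \<comment> \<open>The colour of a kind is a genuine colour only if the kind occurs: the zero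
      word and a word with a single 1 at \<open>j\<close> provide an edge.\<close>
    have "fst (\<gamma> j) \<in> {1..q}" if "j < q" for j
    proof -
      define r where "r = (\<lambda>l. if l = j then 1 else (0::nat))"
      have "r \<in> lex_words \<kappa> q" using that \<kappa>2 by (auto simp: r_def lex_words_def)
      then obtain p0 p1 where p: "p0 < L" "en p0 = (\<lambda>_. 0)" "p1 < L" "en p1 = r"
        using en \<open>(\<lambda>_. 0) \<in> lex_words \<kappa> q\<close> by (metis (no_types, lifting) imageE lessThan_iff)
      have "first_diff q j (?\<eta> p0) (?\<eta> p1)" using p that by (auto simp: r_def first_diff_def)
      moreover have "p0 < L * t" "p1 < L * t" using p(1,3) t(2) by (auto intro: less_le_trans[of _ L])
      ultimately have "{2 * f p0 + 1, 2 * f p1 + 1} \<in> edges ?F \<and> c {2 * f p0 + 1, 2 * f p1 + 1} = fst (\<gamma> j)"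
        using kind that by blast
      then show ?thesis using c_range by metis
    qed
    then have "(\<lambda>j. fst (\<gamma> j)) ` {..<q} \<subseteq> {1..q} - {b}" using nb by auto
    then have "card ((\<lambda>j. fst (\<gamma> j)) ` {..<q}) \<le> card ({1..q} - {b})" by (intro card_mono) auto
    also have "\<dots> < card {..<q}" using b(1) by simp
    finally have "\<not> inj_on (\<lambda>j. fst (\<gamma> j)) {..<q}" by (metis card_image less_irrefl)
    then obtain i j where ij: "i < j" "j < q" "fst (\<gamma> i) = fst (\<gamma> j)"
      unfolding inj_on_def by (metis lessThan_iff linorder_neqE_nat)
    \<comment> \<open>A copy of the complete graph on \<open>Suc \<kappa>\<close> words: colours up
      to \<open>\<kappa>\<close> are told apart by letter \<open>i\<close>. The last one has letter
      0 there, like colour 1, and differs from that colour first at \<open>j\<close>; this uses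
      \<open>i < j\<close>.\<close>
    define \<rho> where "\<rho> v = (\<lambda>l. if col v = Suc \<kappa> then if l = j then 1 else 0
        else if l = i then col v - 1 else 0)" for v
    have "\<rho> ` verts G \<subseteq> lex_words \<kappa> q"
    proof clarify
      fix v assume "v \<in> verts G"
      then have "col v = Suc \<kappa> \<or> col v - 1 < \<kappa>" using colr[of v] by auto
      then show "\<rho> v \<in> lex_words \<kappa> q" using ij \<kappa>2 by (auto simp: \<rho>_def lex_words_def)
    qed
    then obtain X where X: "inj_on X (verts G)" "\<And>v. v \<in> verts G \<Longrightarrow> X v < L * t"
      "\<And>v. v \<in> verts G \<Longrightarrow> ?\<eta> (X v) = \<rho> v"
      using blow_up_embedding[OF fin, of \<rho> en L t] en t(1) by metis
    define g where "g v = 2 * f (X v) + 1" for v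
    have "inj_on g (verts G)"
    proof (rule inj_onI)
      fix u v assume uv: "u \<in> verts G" "v \<in> verts G" "g u = g v"
      then have "X u = X v" using X(2) inj_f by (auto simp: g_def dest: inj_onD)
      then show "u = v" using X(1) uv by (auto dest: inj_onD)
    qed
    moreover have "g ` verts G \<subseteq> verts ?F" using X(2) fV by (auto simp: g_def apex_graph_def)
    moreover have "{g u, g v} \<in> edges ?F \<and> c {g u, g v} = fst (\<gamma> j)" if uv: "{u, v} \<in> edges G" for u v
    proof -
      have mem: "u \<in> verts G" "v \<in> verts G" using graph_edgeD[OF G uv] by auto
      have "first_diff q i (\<rho> u) (\<rho> v) \<or> first_diff q j (\<rho> u) (\<rho> v)"
        using colr[OF mem(1)] colr[OF mem(2)] coln[OF uv] ij
        by (auto simp: \<rho>_def first_diff_def)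
      then obtain l where l: "l < q" "first_diff q l (\<rho> u) (\<rho> v)" "fst (\<gamma> l) = fst (\<gamma> j)"
        using ij by (metis order_less_trans)
      have "first_diff q l (?\<eta> (X u)) (?\<eta> (X v))" using l(2) X(3) mem by simp
      from kind[OF l(1) X(2)[OF mem(1)] X(2)[OF mem(2)] this] l(3)
      show ?thesis by (simp add: g_def)
    qed
    ultimately have "mono_embedding G ?F c (fst (\<gamma> j)) g" unfolding mono_embedding_def by blast
    then show ?thesis by blast
  qed
  then show "\<exists>K. subgraph K ?F \<and> isomorphic G K \<and> (\<exists>i. \<forall>e\<in>edges K. c e = i)"
    using mono_embedding_imp_copy[OF G] by blast
qed

section \<open>Separation by chromatic number and least colour class\<close>

text \<open>For chromatic number 1 the words would have an empty alphabet, so this case stands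
  apart. All of \<open>G\<close> is one colour class, and \<open>card (verts G)\<close> isolated
  vertices contain \<open>G\<close>, while \<open>H\<close> has an edge or too many
  vertices.\<close>

lemma edgeless_separation:
  assumes G: "is_graph G" and H: "is_graph H" and noG: "edges G = {}" and chi: "chromatic_number G = 1"
    and ord: "chromatic_number G < chromatic_number H \<or>
      chromatic_number G = chromatic_number H \<and> min_colour_class G < min_colour_class H"
  shows "\<exists>F :: nat graph. is_graph F \<and> q_ramsey F G q \<and> \<not> q_ramsey F H q"
proof -
  define n where "n = card (verts G)"
  define F :: "nat graph" where "F = ({..<n}, {})"
  have fin: "finite (verts G)" "finite (verts H)" using G H by (auto simp: is_graph_def)
  have "n > 0" using G by (auto simp: n_def is_graph_def card_gt_0_iff)
  then have F: "is_graph F" by (auto simp: F_def is_graph_def)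
  obtain h where h: "bij_betw h (verts G) {0..<n}"
    using ex_bij_betw_finite_nat[OF fin(1)] unfolding n_def by blast
  have "mono_embedding G F c 0 h" for c
    using h noG by (auto simp: mono_embedding_def F_def bij_betw_def)
  then have "q_ramsey F G q" using mono_embedding_imp_copy[OF G] unfolding q_ramsey_def by blast
  moreover have "\<not> q_ramsey F H q"
  proof
    assume "q_ramsey F H q"
    then obtain K where K: "subgraph K F" "isomorphic H K"
      unfolding q_ramsey_def F_def by auto
    have "\<forall>e\<in>edges K. (\<lambda>_. 0) e = (0::nat)" by simp
    from copy_imp_mono_embedding[OF H K this]
    obtain g where g: "mono_embedding H F (\<lambda>_. 0) 0 g" by blast
    then have noH: "{u, v} \<notin> edges H" for u v by (auto simp: mono_embedding_def F_def)
    have "proper_colouring H 1 (\<lambda>_. 1)" using noH by (auto simp: proper_colouring_def)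
    from chromatic_number_le[OF this] ord chi have eq: "chromatic_number H = 1"
      and less: "min_colour_class G < min_colour_class H" by auto
    have "min_colour_class H \<le> card (verts H)"
      using min_colour_class_le[of H "\<lambda>_. 1"] \<open>proper_colouring H 1 (\<lambda>_. 1)\<close> eq by simp
    also have "\<dots> \<le> card {..<n}"
      using g by (intro card_inj_on_le[of g]) (auto simp: mono_embedding_def F_def)
    also have "\<dots> = card (verts G)" by (simp add: n_def)
    also have "\<dots> = min_colour_class G"
    proof -
      obtain f where f: "proper_colouring G (chromatic_number G) f"
        "card {v \<in> verts G. f v = 1} = min_colour_class G"
        using min_colour_class_attained[OF G] .
      then have "{v \<in> verts G. f v = 1} = verts G" unfolding chi by (auto simp: proper_colouring_def)
      then show ?thesis using f(2) by simp
    qed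
    finally show False using less by simp
  qed
  ultimately show ?thesis using F by blast
qed

text \<open>The graph that is smaller in the lexicographic order of chromatic number and least
  colour class is forced, the other one avoided: a colouring of \<open>H\<close> in
  \<open>chromatic_number G\<close> colours does not exist or has a large first class.\<close>

lemma ramsey_separation:
  assumes G: "is_graph G" and H: "is_graph H" and q: "q > 0"
    and ord: "chromatic_number G < chromatic_number H \<or>
      chromatic_number G = chromatic_number H \<and> min_colour_class G < min_colour_class H"
  shows "\<exists>F :: nat graph. is_graph F \<and> q_ramsey F G q \<and> \<not> q_ramsey F H q"
proof -
  obtain col where col: "proper_colouring G (chromatic_number G) col"
    "card {v \<in> verts G. col v = 1} = min_colour_class G"
    using min_colour_class_attained[OF G] .
  have "verts G \<noteq> {}" using G by (simp add: is_graph_def)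
  then have "chromatic_number G \<noteq> 0" using col(1) by (auto simp: proper_colouring_def)
  then consider "chromatic_number G = 1" | "chromatic_number G \<ge> 2" by linarith
  then show ?thesis
  proof cases
    case 1
    have "edges G = {}"
    proof (rule ccontr)
      assume "edges G \<noteq> {}"
      then obtain u v where "{u, v} \<in> edges G" "u \<in> verts G" "v \<in> verts G"
        using graph_edge_cases[OF G] by blast
      moreover have "col w = 1" if "w \<in> verts G" for w
        using col(1) that unfolding 1 by (auto simp: proper_colouring_def)
      ultimately show False using col(1) by (simp add: proper_colouring_def)
    qed
    from edgeless_separation[OF G H this 1 ord] show ?thesis .
  next
    case 2
    define \<kappa> where "\<kappa> = chromatic_number G - 1"
    define s where "s = min_colour_class G"
    \<comment> \<open>One layer for each vertex of \<open>G\<close>, and 3 more to have at least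
      three layers.\<close>
    define t where "t = card (verts G) + 3"
    define m where "m = card (verts H)"
    have \<kappa>: "\<kappa> > 0" and chi: "chromatic_number G = Suc \<kappa>" using 2 by (auto simp: \<kappa>_def)
    interpret homogeneous_template "lex_words \<kappa> q" "first_diff q"
      using \<kappa> by (rule homogeneous_lex_words)
    define L where "L = card (lex_words \<kappa> q)"
    obtain en where "bij_betw en {0..<L} (lex_words \<kappa> q)"
      using ex_bij_betw_nat_finite[OF finite_lex_words] unfolding L_def by blast
    then have en: "en ` {..<L} = lex_words \<kappa> q" by (simp add: bij_betw_def lessThan_atLeast0)
    have "L > 0" using nonempty finite_lex_words[of \<kappa> q] by (simp add: L_def card_gt_0_iff)
    define P where "P = {..<q * s} \<rightarrow>\<^sub>E {1..q}"
    have "finite P" unfolding P_def by (intro finite_PiE) auto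
    then have C: "finite ({1..q} \<times> P \<times> P)" by simp
    have "(\<lambda>x. en (x mod L)) ` {..<L * t} \<subseteq> lex_words \<kappa> q"
      using en \<open>L > 0\<close> by auto
    from sparse_pattern_ramsey[OF _ C this, of "{..q}" m]
    obtain V :: "nat set" and E where V: "finite V" "E \<subseteq> UNIV \<times> V \<times> V"
      and ramsey: "pattern_ramsey (L * t) {..q} (\<lambda>x. en (x mod L)) (first_diff q) V E ({1..q} \<times> P \<times> P)"
      and loc: "\<forall>S\<subseteq>V. card S \<le> m \<longrightarrow> (\<exists>\<psi>. hom_on S E (lex_words \<kappa> q) (first_diff q) \<psi>)"
      by auto
    let ?F = "apex_graph q (q * s) V E"
    have "m > 0" using H by (auto simp: m_def is_graph_def card_gt_0_iff)
    \<comment> \<open>A loop of kind below \<open>q\<close> has no image in the template, yet single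
      vertices are within the sparsity bound \<open>m\<close>.\<close>
    have irrefl: "(i, x, x) \<notin> E" if "i < q" for i x
    proof
      assume x: "(i, x, x) \<in> E"
      then have "{x} \<subseteq> V" "card {x} \<le> m" using V(2) \<open>m > 0\<close> by auto
      then obtain \<psi> where "hom_on {x} E (lex_words \<kappa> q) (first_diff q) \<psi>" using loc by blast
      then show False using x that by (auto simp: hom_on_def first_diff_def)
    qed
    have "V \<noteq> {}"
    proof -
      \<comment> \<open>Any palette element works: a constant colouring already yields a copy with
        at least one position.\<close>
      define z where "z = (1 :: nat, restrict (\<lambda>_. 1 :: nat) {..<q * s}, restrict (\<lambda>_. 1 :: nat) {..<q * s})"
      have "z \<in> {1..q} \<times> P \<times> P" using q by (auto simp: z_def P_def)
      then obtain f \<gamma> where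
        "uniform_copy (L * t) {..q} (\<lambda>x. en (x mod L)) (first_diff q) V E (\<lambda>_. z) f \<gamma>"
        using spec[OF ramsey[unfolded pattern_ramsey_def], of "\<lambda>_. z"] by blast
      then have "f ` {..<L * t} \<subseteq> V" by (simp add: uniform_copy_def)
      moreover have "0 \<in> {..<L * t}" using \<open>L > 0\<close> by (simp add: t_def)
      ultimately show ?thesis by blast
    qed
    have "is_graph ?F" using apex_graph_is_graph[OF V(1) \<open>V \<noteq> {}\<close> V(2) irrefl] .
    moreover have "q_ramsey ?F G q"
      using col by (intro apex_graph_forces[OF G q \<kappa> _ _ _ _ en P_def ramsey]) (auto simp: chi s_def t_def)
    moreover have "\<not> q_ramsey ?F H q"
    proof (rule apex_graph_avoids[OF H q \<kappa>])
      show "\<exists>\<psi>. hom_on S E (lex_words \<kappa> q) (first_diff q) \<psi>"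
        if "S \<subseteq> V" "card S \<le> card (verts H)" for S
        using loc that by (simp add: m_def)
      fix f assume f: "proper_colouring H (Suc \<kappa>) f"
      \<comment> \<open>A colouring of \<open>H\<close> in \<open>chromatic_number G\<close> colours
        rules out the first alternative of \<open>ord\<close>, so the colour classes decide.\<close>
      then have "chromatic_number H = Suc \<kappa>" "s < min_colour_class H"
        using chromatic_number_le[OF f] ord chi by (auto simp: s_def)
      then show "s < card {v \<in> verts H. f v = 1}" using min_colour_class_le[of H f] f by simp
    qed
    ultimately show ?thesis by blast
  qed
qed

theorem theorem8:
  fixes G :: "'a graph" and H :: "'b graph"
  assumes "is_graph G" and "is_graph H"
    and "min_colour_class G < min_colour_class H"
  shows "\<forall>q::nat. q \<ge> 2 \<longrightarrow> \<not> ramsey_equivalent q G H"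
proof (intro allI impI)
  fix q :: nat assume "q \<ge> 2"
  then have q: "q > 0" by simp
  show "\<not> ramsey_equivalent q G H"
  \<comment> \<open>If \<open>H\<close> has the smaller chromatic number, the two graphs exchange
    roles and this number alone decides.\<close>
  proof (cases "chromatic_number G \<le> chromatic_number H")
    case True
    then obtain F :: "nat graph" where "is_graph F" "q_ramsey F G q" "\<not> q_ramsey F H q"
      using ramsey_separation[OF assms(1,2) q] assms(3) le_neq_implies_less by blast
    then show ?thesis unfolding ramsey_equivalent_def by blast
  next
    case False
    then obtain F :: "nat graph" where "is_graph F" "q_ramsey F H q" "\<not> q_ramsey F G q"
      using ramsey_separation[OF assms(2,1) q] not_le_imp_less by blast
    then show ?thesis unfolding ramsey_equivalent_def by blast
  qed
qed

end
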